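(* Let $\Gamma=(X,\mathcal E)$ be the Heawood graph (the distance-regular graph with $14$ vertices and intersection array $\{3,2,2;1,1,3\}$); the spectrum of its adjacency matrix $A$ is $3^1(\sqrt2)^6(-\sqrt2)^6(-3)^1$. Let $x\in X$ and $T=T(x)$. Order the three vertices of $\Gamma_1(x)$ arbitrarily, and order $\Gamma_2(x)$ as $y_1,\dots,y_6$ so that each of the pairs $\{y_1,y_2\},\{y_3,y_4\},\{y_5,y_6\}$ has a common neighbor in $\Gamma_1(x)$. Then the standard module $V=\mathbb C^X$ is an orthogonal direct sum of irreducible $T$-modules $V=W_0\oplus W_{1,a}\oplus W_{1,b}\oplus W_{2,a}\oplus W_{2,b}\oplus W_{2,c}$, where two summands are isomorphic if and only if they have the same type in the following list, and the data are as listed. Each listed basis is a pure basis of the module. For each summand other than $W_0$, the seed vector $\nu$ spans $E_r^*W$ (so $\dim E_r^*W=1$), where $r$ is the endpoint of the summand $W$, and is given by its essential part. Type I ($W_0$): endpoint 0, multiplicity 1, dimension 4, diameter 3, shape $(1,1,1,1)$; basis $e_0^*,e_1^*,e_2^*,e_3^*$; matrix representing $A$: $\begin{pmatrix}0&3&0&0\\1&0&2&0\\0&1&0&2\\0&0&3&0\end{pmatrix}$, with eigenvalues $3,\sqrt2,-\sqrt2,-3$. Type II ($W_{1,a},W_{1,b}$): endpoint 1, multiplicity 2, dimension 2, diameter 1, shape $(1,1)$; basis $\nu,A\nu$ (with $A\nu=E_2^*A\nu$), where $\nu=[1,-1,0]$ for $W_{1,a}$ and $\nu=[1,1,-2]$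 for $W_{1,b}$; matrix representing $A$: $\begin{pmatrix}0&2\\1&0\end{pmatrix}$, with eigenvalues $\sqrt2,-\sqrt2$. Type III ($W_{2,a},W_{2,b},W_{2,c}$): endpoint 2, multiplicity 3, dimension 2, diameter 1, shape $(1,1)$; basis $\nu,A\nu$ (with $A\nu=E_3^*A\nu$), where $\nu=[1,-1,0,0,0,0]$ for $W_{2,a}$, $\nu=[0,0,1,-1,0,0]$ for $W_{2,b}$, $\nu=[0,0,0,0,1,-1]$ for $W_{2,c}$; matrix representing $A$: $\begin{pmatrix}0&2\\1&0\end{pmatrix}$. Moreover $\dim T=4^2+2^2+2^2=24$.
   Context: Let $\Gamma=(X,\mathcal E)$ be a finite undirected connected graph without loops or multiple edges, with path-length distance $d$ and diameter $D\ge1$; put $\Gamma_i(x)=\{y\in X:d(x,y)=i\}$. $\Gamma$ is distance-regular if for all $0\le h,i,j\le D$ the number $p^h_{i,j}=|\Gamma_i(y)\cap\Gamma_j(z)|$ is the same for all $y,z\in X$ with $d(y,z)=h$. Its intersection array is $\{b_0,\dots,b_{D-1};c_1,\dots,c_D\}$ with $b_i=p^i_{1,i+1}$, $c_i=p^i_{1,i-1}$. $A\in\mathrm{Mat}_X(\mathbb C)$ is the adjacency matrix; in its spectrum, exponents denote multiplicities. The standard module $V=\mathbb C^X$ (column vectors) carries the Hermitian inner product $\langle u,v\rangle=u^t\bar v$. Fix a base vertex $x\in X$. For $0\le i\le D$, $E_i^*=E_i^*(x)$ is the diagonal matrix with $(y,y)$-entry $1$ if $d(x,y)=i$ and $0$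 otherwise, and $e_i^*\in V$ is the vector with $y$-entry $1$ if $d(x,y)=i$ and $0$ otherwise. The Terwilliger algebra $T=T(x)$ is the subalgebra of $\mathrm{Mat}_X(\mathbb C)$ generated by $A$ and $E_0^*,\dots,E_D^*$. A $T$-module is a subspace $W\subseteq V$ with $BW\subseteq W$ for all $B\in T$; it is irreducible if $W\ne0$ and it properly contains no nonzero $T$-module. Isomorphisms of $T$-modules are vector space isomorphisms commuting with every $B\in T$. The endpoint of $W$ is $r=\min\{i:E_i^*W\ne0\}$; the diameter of an irreducible $W$ is $\delta=|\{i:E_i^*W\ne0\}|-1$, and its shape is $(\dim E_r^*W,\dots,\dim E_{r+\delta}^*W)$. The multiplicity of an irreducible module is the number of summands isomorphic to it in an orthogonal decomposition of $V$ into irreducible $T$-modules. A nonzero vector is pure with support $i$ if it lies in $E_i^*V$; its essential part is the row vector of its coordinates at the vertices of $\Gamma_i(x)$, in the chosen order (all its other coordinates are $0$). A pure basis of an irreducible $T$-module is an ordered basis of pure vectors with weakly increasing supports. The matrix $B$ representing $A$ with respect to a basis $v_1,\dots,v_\ell$ is given by $Av_j=\sum_iB_{ij}v_i$. *)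

theory Defs
  imports "Jordan_Normal_Form.Char_Poly" "HOL-Analysis.Analysis"
begin

text \<open>
  Graphs are adjacency relations on a finite vertex type.  Matrices and vectors indexed by
  vertices use the types of Finite-Cartesian-Product; the small matrices that represent the
  adjacency matrix with respect to an ordered basis (a list) use \<open>Matrix.mat\<close>, indexed from 0.
\<close>

no_notation vec_index (infixl "$" 100)


definition simple_graph :: "('v \<Rightarrow> 'v \<Rightarrow> bool) \<Rightarrow> bool" where
  "simple_graph adj \<longleftrightarrow> symp adj \<and> irreflp adj"

definition connected_graph :: "('v \<Rightarrow> 'v \<Rightarrow> bool) \<Rightarrow> bool" where
  "connected_graph adj \<longleftrightarrow> (\<forall>y z. adj\<^sup>*\<^sup>* y z)"

text \<open>A shortest walk is a path, so minimising over walks gives the path-length distance.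
  It is only meaningful for connected graphs.\<close>

definition gdist :: "('v \<Rightarrow> 'v \<Rightarrow> bool) \<Rightarrow> 'v \<Rightarrow> 'v \<Rightarrow> nat" where
  "gdist adj y z = (LEAST n. (adj ^^ n) y z)"

definition graph_diameter :: "('v::finite \<Rightarrow> 'v \<Rightarrow> bool) \<Rightarrow> nat" where
  "graph_diameter adj = Max {gdist adj y z | y z. True}"

definition dist_sphere :: "('v \<Rightarrow> 'v \<Rightarrow> bool) \<Rightarrow> nat \<Rightarrow> 'v \<Rightarrow> 'v set" where
  "dist_sphere adj i x = {y. gdist adj x y = i}"

definition distance_regular :: "('v::finite \<Rightarrow> 'v \<Rightarrow> bool) \<Rightarrow> bool" where
  "distance_regular adj \<longleftrightarrow>
     simple_graph adj \<and> connected_graph adj \<and> graph_diameter adj \<ge> 1 \<and>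
     (\<forall>h \<le> graph_diameter adj. \<forall>i \<le> graph_diameter adj. \<forall>j \<le> graph_diameter adj.
        \<exists>p. \<forall>y z. gdist adj y z = h \<longrightarrow>
             card (dist_sphere adj i y \<inter> dist_sphere adj j z) = p)"

definition intersection_number :: "('v::finite \<Rightarrow> 'v \<Rightarrow> bool) \<Rightarrow> nat \<Rightarrow> nat \<Rightarrow> nat \<Rightarrow> nat" where
  "intersection_number adj h i j =
     (THE p. \<forall>y z. gdist adj y z = h \<longrightarrow>
               card (dist_sphere adj i y \<inter> dist_sphere adj j z) = p)"

definition intersection_array :: "('v::finite \<Rightarrow> 'v \<Rightarrow> bool) \<Rightarrow> nat list \<times> nat list" where
  "intersection_array adj =
     (map (\<lambda>i. intersection_number adj i 1 (i + 1)) [0 ..< graph_diameter adj],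
      map (\<lambda>i. intersection_number adj i 1 (i - 1)) [1 ..< graph_diameter adj + 1])"


definition adjacency_matrix :: "('v::finite \<Rightarrow> 'v \<Rightarrow> bool) \<Rightarrow> complex ^ 'v ^ 'v" where
  "adjacency_matrix adj = (\<chi> y z. if adj y z then 1 else 0)"

definition eigenspace :: "complex ^ 'v ^ 'v \<Rightarrow> complex \<Rightarrow> (complex ^ 'v::finite) set" where
  "eigenspace M \<theta> = {v. M *v v = \<theta> *s v}"

text \<open>Eigenvalues together with their geometric multiplicities (which are the algebraic ones
  for the symmetric real matrices considered here).\<close>

definition spectrum_mult :: "complex ^ 'v ^ 'v::finite \<Rightarrow> (complex \<times> nat) set" where
  "spectrum_mult M = {(\<theta>, vec.dim (eigenspace M \<theta>)) | \<theta>. eigenspace M \<theta> \<noteq> {0}}"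

text \<open>The Hermitian inner product; the library's inner product on this type is its real part.\<close>

definition hermitian_inner :: "complex ^ 'v::finite \<Rightarrow> complex ^ 'v \<Rightarrow> complex" where
  "hermitian_inner u v = (\<Sum>y\<in>UNIV. u $ y * cnj (v $ y))"

definition dual_idempotent :: "('v::finite \<Rightarrow> 'v \<Rightarrow> bool) \<Rightarrow> 'v \<Rightarrow> nat \<Rightarrow> complex ^ 'v ^ 'v" where
  "dual_idempotent adj x i = (\<chi> y z. if y = z \<and> gdist adj x y = i then 1 else 0)"

definition sphere_vector :: "('v::finite \<Rightarrow> 'v \<Rightarrow> bool) \<Rightarrow> 'v \<Rightarrow> nat \<Rightarrow> complex ^ 'v" where
  "sphere_vector adj x i = (\<chi> y. if gdist adj x y = i then 1 else 0)"

definition cscale_matrix :: "complex \<Rightarrow> complex ^ 'n ^ 'm \<Rightarrow> complex ^ 'n::finite ^ 'm::finite" where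
  "cscale_matrix c M = map_matrix ((*) c) M"

text \<open>The ambient vector space structure on matrices is real; dimensions of matrix algebras
  have to be taken over the complex numbers.\<close>

global_interpretation cmat: vector_space "cscale_matrix :: complex \<Rightarrow> complex ^ 'n ^ 'm \<Rightarrow> complex ^ 'n::finite ^ 'm::finite"
  by unfold_locales (simp_all add: cscale_matrix_def Finite_Cartesian_Product.vec_eq_iff algebra_simps)

definition matrix_subalgebra :: "(complex ^ 'v ^ 'v::finite) set \<Rightarrow> bool" where
  "matrix_subalgebra S \<longleftrightarrow>
     cmat.subspace S \<and> Finite_Cartesian_Product.mat 1 \<in> S \<and> (\<forall>M\<in>S. \<forall>N\<in>S. M ** N \<in> S)"

definition terwilliger_algebra ::
    "('v::finite \<Rightarrow> 'v \<Rightarrow> bool) \<Rightarrow> 'v \<Rightarrow> (complex ^ 'v ^ 'v) set" where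
  "terwilliger_algebra adj x =
     matrix_subalgebra hull
       ({adjacency_matrix adj} \<union> {dual_idempotent adj x i | i. i \<le> graph_diameter adj})"


definition alg_module :: "(complex ^ 'v ^ 'v) set \<Rightarrow> (complex ^ 'v::finite) set \<Rightarrow> bool" where
  "alg_module T W \<longleftrightarrow> vec.subspace W \<and> (\<forall>B\<in>T. \<forall>w\<in>W. B *v w \<in> W)"

definition irreducible_module :: "(complex ^ 'v ^ 'v) set \<Rightarrow> (complex ^ 'v::finite) set \<Rightarrow> bool" where
  "irreducible_module T W \<longleftrightarrow>
     alg_module T W \<and> W \<noteq> {0} \<and> (\<forall>U. alg_module T U \<and> U \<subset> W \<longrightarrow> U = {0})"

definition isomorphic_modules ::
    "(complex ^ 'v ^ 'v) set \<Rightarrow> (complex ^ 'v::finite) set \<Rightarrow> (complex ^ 'v) set \<Rightarrow> bool" where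
  "isomorphic_modules T U W \<longleftrightarrow>
     (\<exists>f. bij_betw f U W \<and>
          (\<forall>u\<in>U. \<forall>v\<in>U. f (u + v) = f u + f v) \<and>
          (\<forall>c. \<forall>u\<in>U. f (c *s u) = c *s f u) \<and>
          (\<forall>B\<in>T. \<forall>u\<in>U. f (B *v u) = B *v f u))"

definition orthogonal_direct_sum :: "(complex ^ 'v::finite) set list \<Rightarrow> bool" where
  "orthogonal_direct_sum Ws \<longleftrightarrow>
     (\<forall>i < length Ws. \<forall>j < length Ws. i \<noteq> j \<longrightarrow>
        (\<forall>u \<in> Ws ! i. \<forall>v \<in> Ws ! j. hermitian_inner u v = 0)) \<and>
     (\<forall>v. \<exists>!ws. length ws = length Ws \<and> (\<forall>i < length Ws. ws ! i \<in> Ws ! i) \<and> sum_list ws = v)"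

definition orthogonal_irreducible_decomposition ::
    "(complex ^ 'v ^ 'v) set \<Rightarrow> (complex ^ 'v::finite) set list \<Rightarrow> bool" where
  "orthogonal_irreducible_decomposition T Ws \<longleftrightarrow>
     (\<forall>W \<in> set Ws. irreducible_module T W) \<and> orthogonal_direct_sum Ws"

text \<open>The multiplicity does not depend on the decomposition; this is made part of the
  notion.\<close>

definition has_multiplicity ::
    "(complex ^ 'v ^ 'v) set \<Rightarrow> (complex ^ 'v::finite) set \<Rightarrow> nat \<Rightarrow> bool" where
  "has_multiplicity T W m \<longleftrightarrow>
     (\<exists>Ws. orthogonal_irreducible_decomposition T Ws) \<and>
     (\<forall>Ws. orthogonal_irreducible_decomposition T Ws \<longrightarrow>
        length (filter (isomorphic_modules T W) Ws) = m)"


definition component ::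
    "('v::finite \<Rightarrow> 'v \<Rightarrow> bool) \<Rightarrow> 'v \<Rightarrow> nat \<Rightarrow> (complex ^ 'v) set \<Rightarrow> (complex ^ 'v) set" where
  "component adj x i W = (\<lambda>w. dual_idempotent adj x i *v w) ` W"

definition module_support ::
    "('v::finite \<Rightarrow> 'v \<Rightarrow> bool) \<Rightarrow> 'v \<Rightarrow> (complex ^ 'v) set \<Rightarrow> nat set" where
  "module_support adj x W = {i. i \<le> graph_diameter adj \<and> component adj x i W \<noteq> {0}}"

definition endpoint :: "('v::finite \<Rightarrow> 'v \<Rightarrow> bool) \<Rightarrow> 'v \<Rightarrow> (complex ^ 'v) set \<Rightarrow> nat" where
  "endpoint adj x W = Min (module_support adj x W)"

definition module_diameter :: "('v::finite \<Rightarrow> 'v \<Rightarrow> bool) \<Rightarrow> 'v \<Rightarrow> (complex ^ 'v) set \<Rightarrow> nat" where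
  "module_diameter adj x W = card (module_support adj x W) - 1"

definition module_shape :: "('v::finite \<Rightarrow> 'v \<Rightarrow> bool) \<Rightarrow> 'v \<Rightarrow> (complex ^ 'v) set \<Rightarrow> nat list" where
  "module_shape adj x W =
     map (\<lambda>i. vec.dim (component adj x i W))
       [endpoint adj x W ..< endpoint adj x W + module_diameter adj x W + 1]"

definition pure_vector :: "('v::finite \<Rightarrow> 'v \<Rightarrow> bool) \<Rightarrow> 'v \<Rightarrow> nat \<Rightarrow> complex ^ 'v \<Rightarrow> bool" where
  "pure_vector adj x i v \<longleftrightarrow>
     i \<le> graph_diameter adj \<and> v \<noteq> 0 \<and> v \<in> component adj x i UNIV"

text \<open>The coordinates of \<open>v\<close> along an ordering \<open>ys\<close> of the vertices of a sphere.\<close>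

definition essential_part :: "'v list \<Rightarrow> complex ^ 'v::finite \<Rightarrow> complex list" where
  "essential_part ys v = map (\<lambda>y. v $ y) ys"

definition ordered_basis :: "(complex ^ 'v::finite) set \<Rightarrow> (complex ^ 'v) list \<Rightarrow> bool" where
  "ordered_basis W vs \<longleftrightarrow>
     distinct vs \<and> vec.independent (set vs) \<and> vec.span (set vs) = W"

definition pure_basis ::
    "('v::finite \<Rightarrow> 'v \<Rightarrow> bool) \<Rightarrow> 'v \<Rightarrow> (complex ^ 'v) set \<Rightarrow> (complex ^ 'v) list \<Rightarrow> bool" where
  "pure_basis adj x W vs \<longleftrightarrow>
     ordered_basis W vs \<and>
     (\<exists>supps. length supps = length vs \<and> sorted supps \<and>
        (\<forall>j < length vs. pure_vector adj x (supps ! j) (vs ! j)))"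

definition represents ::
    "complex Matrix.mat \<Rightarrow> complex ^ 'v ^ 'v \<Rightarrow> (complex ^ 'v::finite) list \<Rightarrow> bool" where
  "represents B M vs \<longleftrightarrow>
     B \<in> carrier_mat (length vs) (length vs) \<and>
     (\<forall>j < length vs. M *v (vs ! j) = (\<Sum>i < length vs. (B $$ (i, j)) *s (vs ! i)))"

definition module_data ::
    "('v::finite \<Rightarrow> 'v \<Rightarrow> bool) \<Rightarrow> 'v \<Rightarrow> (complex ^ 'v) set \<Rightarrow> nat \<Rightarrow> nat \<Rightarrow> nat \<Rightarrow> nat \<Rightarrow> nat list \<Rightarrow>
     (complex ^ 'v) list \<Rightarrow> complex Matrix.mat \<Rightarrow> bool" where
  "module_data adj x W r m dm \<delta> sh vs B \<longleftrightarrow>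
     endpoint adj x W = r \<and>
     has_multiplicity (terwilliger_algebra adj x) W m \<and>
     vec.dim W = dm \<and>
     module_diameter adj x W = \<delta> \<and>
     module_shape adj x W = sh \<and>
     pure_basis adj x W vs \<and>
     represents B (adjacency_matrix adj) vs"

definition seed_vector ::
    "('v::finite \<Rightarrow> 'v \<Rightarrow> bool) \<Rightarrow> 'v \<Rightarrow> (complex ^ 'v) set \<Rightarrow> 'v list \<Rightarrow> complex list \<Rightarrow>
     complex ^ 'v \<Rightarrow> bool" where
  "seed_vector adj x W ys es \<nu> \<longleftrightarrow>
     pure_vector adj x (endpoint adj x W) \<nu> \<and>
     set ys = dist_sphere adj (endpoint adj x W) x \<and>
     essential_part ys \<nu> = es \<and>
     component adj x (endpoint adj x W) W = vec.span {\<nu>} \<and>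
     vec.dim (component adj x (endpoint adj x W) W) = 1"

end

theory Submission
  imports Defs
begin

text \<open>
  The array forces \<open>A\<^sup>2 = 2 I + K\<close>, where \<open>K\<close> is the indicator of the two colour classes.  Hence \<open>A\<^sup>2\<close> acts
  as \<open>2\<close> on every vector orthogonal to the spheres \<open>e\<^sub>i\<^sup>*\<close>, so a vector of \<open>\<Gamma>\<^sub>t\<close> that is killed by the
  lowering part of \<open>A\<close> and is orthogonal to the spheres generates a two-dimensional module.  With the
  projections \<open>F t\<close> onto these vectors (\<open>t = 1, 2\<close>), the products \<open>A\<^sup>i F t A\<^sup>j\<close> and the rank one
  matrices \<open>e\<^sub>i\<^sup>* (e\<^sub>j\<^sup>*)\<^sup>T\<close> are, up to scalars, matrix units of an algebra with blocks of size 4, 2 and 2 which turns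
  out to be \<open>T\<close>.  Irreducible modules, isomorphisms and multiplicities are then read off the matrix
  units: the number of summands of a given type in any decomposition is the rank of a diagonal unit.
\<close>

section \<open>Algebras spanned by matrix units\<close>

text \<open>No model of the graph is chosen: everything is computed from neighbour counts relative
  to \<open>x\<close>. The formula for \<open>A^2\<close> holds because distinct vertices of one
  colour are at distance 2 and \<open>c_2 = 1\<close>. \<open>T\<close> is known only as the
  smallest subalgebra containing its generators, so neither its dimension nor its modules are
  accessible before it is identified with an explicit span. Sandwiching an element between two
  matrix units then does the work of Schur's lemma. The constants in \<open>F\<close>:
  \<open>s 1\<close> has square norm 3, hence the 1/3 in \<open>F 1\<close>, which removes the line
  of \<open>s 1\<close>. Each vertex of sphere 1 has two neighbours in sphere 2 and no two of them
  share one, so \<open>D 1 A D 2 A D 1 = 2 D 1\<close>; hence half of \<open>D 2 A D 1 A D 2\<close>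
  is the projection onto the part of sphere 2 reached from sphere 1, and \<open>F 2\<close> removes
  it. The sphere sizes 1, 3, 6, 4 split as 1, 1+2, 1+2+3, 1+3. This is the resolution of the
  identity into diagonal units, and it shows the multiplicities 1, 2, 3.\<close>

lemma cscale_matrix_nth [simp]: "cscale_matrix c M $ i $ j = c * M $ i $ j"
  by (simp add: cscale_matrix_def)

lemma cscale_matrix_mult_left: "cscale_matrix c M ** N = cscale_matrix c (M ** N)"
  by (simp add: Finite_Cartesian_Product.vec_eq_iff matrix_matrix_mult_def sum_distrib_left mult.assoc)

lemma cscale_matrix_mult_right: "M ** cscale_matrix c N = cscale_matrix c (M ** N)"
  by (simp add: Finite_Cartesian_Product.vec_eq_iff matrix_matrix_mult_def sum_distrib_left mult_ac)

lemma cscale_matrix_vector_mult: "cscale_matrix c M *v v = c *s (M *v v)"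
  by (simp add: Finite_Cartesian_Product.vec_eq_iff matrix_vector_mult_def sum_distrib_left mult_ac)

lemma matrix_vector_mult_sum_left: "(\<Sum>i\<in>S. M i) *v v = (\<Sum>i\<in>S. M i *v (v :: complex ^ 'n))"
  by (induction S rule: infinite_finite_induct) (simp_all add: matrix_vector_mult_add_rdistrib)

lemma matrix_vector_mult_sum_right: "M *v (\<Sum>i\<in>S. v i) = (\<Sum>i\<in>S. M *v (v i :: complex ^ 'n))"
  by (induction S rule: infinite_finite_induct) (simp_all add: matrix_vector_right_distrib)

lemma matrix_zero_left: "0 ** (M :: complex ^ 'n ^ 'm) = 0"
  by (simp add: Finite_Cartesian_Product.vec_eq_iff matrix_matrix_mult_def)

lemma matrix_zero_right: "(M :: complex ^ 'n ^ 'm) ** 0 = 0"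
  by (simp add: Finite_Cartesian_Product.vec_eq_iff matrix_matrix_mult_def)

lemma matrix_add_rdistrib: "(B + C) ** A = B ** A + C ** (A :: complex ^ 'n ^ 'm)"
  by (simp add: Finite_Cartesian_Product.vec_eq_iff matrix_matrix_mult_def sum.distrib distrib_right)

lemma matrix_mult_sum_left: "(\<Sum>i\<in>S. M i) ** N = (\<Sum>i\<in>S. M i ** (N :: complex ^ 'n ^ 'm))"
  by (induction S rule: infinite_finite_induct) (simp_all add: matrix_add_rdistrib matrix_zero_left)

lemma matrix_mult_sum_right: "N ** (\<Sum>i\<in>S. M i) = (\<Sum>i\<in>S. N ** (M i :: complex ^ 'n ^ 'm))"
  by (induction S rule: infinite_finite_induct) (simp_all add: matrix_add_ldistrib matrix_zero_right)

lemma matrix_vector_mult_scale: "M *v (c *s v) = c *s (M *v (v :: complex ^ 'n))"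
  by (simp add: vector_scalar_commute)

lemma alg_module_sum_mem:
  assumes "alg_module T W" "\<And>i. i \<in> S \<Longrightarrow> f i \<in> W"
  shows "sum f S \<in> W"
  using assms by (auto simp: alg_module_def intro: vec.subspace_sum)

text \<open>The type \<open>t\<close> names a block and \<open>I t\<close> its rows, so blocks may
  differ in size. \<open>root t\<close> marks one row; the range of its diagonal unit serves as the
  multiplicity space of the block. Nonvanishing is asked only there, since every other unit of the
  block can be multiplied into it (\<open>unit_neq_zero\<close>).\<close>

locale matrix_units =
  fixes e :: "'t \<Rightarrow> 'i \<Rightarrow> 'i \<Rightarrow> complex ^ 'v ^ 'v::finite"
    and Ts :: "'t set" and I :: "'t \<Rightarrow> 'i set" and root :: "'t \<Rightarrow> 'i"
  assumes finite_types: "finite Ts" and finite_indices: "t \<in> Ts \<Longrightarrow> finite (I t)"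
    and root_index: "t \<in> Ts \<Longrightarrow> root t \<in> I t"
    and unit_mult: "\<lbrakk>t \<in> Ts; i \<in> I t; j \<in> I t; s \<in> Ts; k \<in> I s; l \<in> I s\<rbrakk> \<Longrightarrow>
       e t i j ** e s k l = (if t = s \<and> j = k then e t i l else 0)"
    and unit_sum: "(\<Sum>t\<in>Ts. \<Sum>i\<in>I t. e t i i) = Finite_Cartesian_Product.mat 1"
    and unit_nonzero: "t \<in> Ts \<Longrightarrow> e t (root t) (root t) \<noteq> 0"
begin

definition units :: "(complex ^ 'v ^ 'v) set" where
  "units = (\<lambda>(t, i, j). e t i j) ` (SIGMA t:Ts. I t \<times> I t)"

definition alg :: "(complex ^ 'v ^ 'v) set" where
  "alg = cmat.span units"

lemma unit_in_alg: "\<lbrakk>t \<in> Ts; i \<in> I t; j \<in> I t\<rbrakk> \<Longrightarrow> e t i j \<in> alg"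
  unfolding alg_def units_def by (rule cmat.span_base) force

lemma alg_induct [consumes 1, case_names zero add scale unit]:
  assumes "B \<in> alg" "P 0" "\<And>B C. \<lbrakk>B \<in> alg; C \<in> alg; P B; P C\<rbrakk> \<Longrightarrow> P (B + C)"
    "\<And>c B. \<lbrakk>B \<in> alg; P B\<rbrakk> \<Longrightarrow> P (cscale_matrix c B)"
    "\<And>t i j. \<lbrakk>t \<in> Ts; i \<in> I t; j \<in> I t\<rbrakk> \<Longrightarrow> P (e t i j)"
  shows "P B"
proof -
  \<comment> \<open>Membership is proved along with \<open>P\<close>, because the premises for sums
    and multiples assume it.\<close>
  have "B \<in> alg \<and> P B"
    using assms(1) unfolding alg_def
  proof (induction rule: cmat.span_induct_alt)
    case base
    then show ?case using assms(2) by (simp add: cmat.span_zero)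
  next
    case (step c x y)
    then have x: "x \<in> alg" "P x"
      using assms(5) unit_in_alg by (auto simp: units_def)
    then have "cscale_matrix c x \<in> alg" "P (cscale_matrix c x)"
      using assms(4) by (auto simp: alg_def cmat.span_scale)
    with step assms(3) show ?case
      by (simp add: alg_def cmat.span_add)
  qed
  then show ?thesis ..
qed

lemma alg_subspace: "cmat.subspace alg"
  by (simp add: alg_def cmat.subspace_span)

lemma one_in_alg: "Finite_Cartesian_Product.mat 1 \<in> alg"
  unfolding unit_sum[symmetric]
  by (intro cmat.subspace_sum[OF alg_subspace] unit_in_alg)

lemma unit_mult_in_alg:
  assumes "t \<in> Ts" "i \<in> I t" "j \<in> I t" "C \<in> alg"
  shows "e t i j ** C \<in> alg"
  using assms(4)
proof (induction rule: alg_induct)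
  case zero
  then show ?case using alg_subspace by (simp add: cmat.subspace_0)
next
  case (unit s k l)
  then show ?case
    using assms alg_subspace by (auto simp: unit_mult intro!: unit_in_alg cmat.subspace_0)
qed (use alg_subspace in \<open>auto simp: matrix_add_ldistrib cscale_matrix_mult_right
       intro: cmat.subspace_add cmat.subspace_scale\<close>)

lemma matrix_subalgebra_alg: "matrix_subalgebra alg"
proof -
  have "B ** C \<in> alg" if "B \<in> alg" "C \<in> alg" for B C
    using that
  proof (induction rule: alg_induct)
    case zero
    then show ?case using alg_subspace by (simp add: cmat.subspace_0)
  qed (use alg_subspace in \<open>auto simp: matrix_add_rdistrib cscale_matrix_mult_left unit_mult_in_alg
       intro: cmat.subspace_add cmat.subspace_scale\<close>)
  then show ?thesis
    by (auto simp: matrix_subalgebra_def alg_subspace one_in_alg)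
qed

text \<open>On block \<open>t\<close>, \<open>B\<close> acts as a matrix, and cutting it between two
  units leaves only its entry at \<open>(j, k)\<close>, which is \<open>c\<close>. There are no
  entries between different blocks.\<close>

lemma unit_sandwich:
  assumes "B \<in> alg" and t: "t \<in> Ts" "i \<in> I t" "j \<in> I t" and s: "s \<in> Ts" "k \<in> I s" "l \<in> I s"
  shows "\<exists>c. e t i j ** B ** e s k l = (if t = s then cscale_matrix c (e t i l) else 0)"
  using assms(1)
proof (induction rule: alg_induct)
  case zero
  have "cscale_matrix 0 (e t i l) = 0" by (simp add: cmat.scale_zero_left)
  then show ?case by (auto intro: exI[of _ 0])
next
  case (add B C)
  then show ?case
    by (auto simp: matrix_add_ldistrib matrix_add_rdistrib simp flip: cmat.scale_left_distrib)
next
  case (scale c B)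
  then obtain b where "e t i j ** B ** e s k l = (if t = s then cscale_matrix b (e t i l) else 0)"
    by blast
  then show ?case
    by (auto simp: cscale_matrix_mult_left cscale_matrix_mult_right cmat.scale_zero_right)
next
  case (unit q m n)
  have "\<exists>c. e t i l = cscale_matrix c (e t i l)" "\<exists>c. 0 = cscale_matrix c (e t i l)"
    by (metis cmat.scale_one, metis cmat.scale_zero_left)
  with unit t s show ?case
    by (auto simp: unit_mult)
qed

lemma unit_neq_zero:
  assumes t: "t \<in> Ts" "i \<in> I t" "j \<in> I t"
  shows "e t i j \<noteq> 0"
proof
  assume "e t i j = 0"
  then have "e t (root t) i ** e t i j ** e t j (root t) = 0"
    by (simp add: matrix_zero_left matrix_zero_right)
  with t unit_nonzero[OF t(1)] root_index[OF t(1)] show False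
    by (simp add: unit_mult)
qed

text \<open>The diagonal units on both sides kill every other term, so a linear combination
  determines its coefficients; this is the linear independence behind
  \<open>dim_alg\<close>.\<close>

lemma unit_coeff:
  assumes "t \<in> Ts" "i \<in> I t" "j \<in> I t"
  shows "e t i i ** (\<Sum>(s, k, l)\<in>(SIGMA s:Ts. I s \<times> I s). cscale_matrix (c s k l) (e s k l)) ** e t j j
    = cscale_matrix (c t i j) (e t i j)" (is "_ ** (\<Sum>x\<in>?S. _) ** _ = _")
proof -
  have "finite ?S"
    using finite_types finite_indices by auto
  have "e t i i ** (\<Sum>(s, k, l)\<in>?S. cscale_matrix (c s k l) (e s k l)) ** e t j j
      = (\<Sum>(s, k, l)\<in>?S. e t i i ** cscale_matrix (c s k l) (e s k l) ** e t j j)"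
    by (simp add: matrix_mult_sum_left matrix_mult_sum_right case_prod_unfold)
  also have "\<dots> = (\<Sum>x\<in>?S. if x = (t, i, j) then cscale_matrix (c t i j) (e t i j) else 0)"
  proof (rule sum.cong, simp)
    fix x assume "x \<in> ?S"
    then obtain s k l where "x = (s, k, l)" "s \<in> Ts" "k \<in> I s" "l \<in> I s" by auto
    with assms show "(case x of (s, k, l) \<Rightarrow> e t i i ** cscale_matrix (c s k l) (e s k l) ** e t j j)
       = (if x = (t, i, j) then cscale_matrix (c t i j) (e t i j) else 0)"
      by (auto simp: unit_mult cscale_matrix_mult_left cscale_matrix_mult_right)
  qed
  also have "\<dots> = cscale_matrix (c t i j) (e t i j)"
    using assms \<open>finite ?S\<close> by simp
  finally show ?thesis .
qed

lemma dim_alg: "cmat.dim alg = (\<Sum>t\<in>Ts. (card (I t))\<^sup>2)"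
proof -
  let ?S = "SIGMA t:Ts. I t \<times> I t" and ?e = "\<lambda>(t, i, j). e t i j"
  have fin: "finite ?S"
    using finite_types finite_indices by auto
  have inj: "inj_on ?e ?S"
  proof (rule inj_onI)
    fix a b assume ab: "a \<in> ?S" "b \<in> ?S" "?e a = ?e b"
    obtain t i j s k l where abeq: "a = (t, i, j)" "b = (s, k, l)"
      by (metis prod_cases3)
    with ab have *: "t \<in> Ts" "i \<in> I t" "j \<in> I t" "s \<in> Ts" "k \<in> I s" "l \<in> I s"
      and eq: "e t i j = e s k l" by auto
    \<comment> \<open>The two diagonal units preserve \<open>e t i j\<close> and kill every unit
      with other indices, so equal matrices have equal index triples.\<close>
    from * have "e t i i ** e t i j ** e t j j \<noteq> 0"
      by (simp add: unit_mult unit_neq_zero)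
    then have "e t i i ** e s k l ** e t j j \<noteq> 0"
      by (simp add: eq)
    with * show "a = b"
      by (auto simp: abeq unit_mult matrix_zero_left split: if_splits)
  qed
  have "\<not> cmat.dependent units"
  proof
    assume "cmat.dependent units"
    then obtain u where u: "(\<Sum>M\<in>units. cscale_matrix (u M) M) = 0" "\<exists>M\<in>units. u M \<noteq> 0"
      using cmat.dependent_finite[of units] fin unfolding units_def by auto
    from u(2) obtain t i j where t: "t \<in> Ts" "i \<in> I t" "j \<in> I t" "u (e t i j) \<noteq> 0"
      unfolding units_def by auto
    have "(\<Sum>M\<in>units. cscale_matrix (u M) M) = (\<Sum>(s, k, l)\<in>?S. cscale_matrix (u (e s k l)) (e s k l))"
      unfolding units_def by (subst sum.reindex[OF inj]) (simp add: case_prod_unfold)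
    with u(1) unit_coeff[OF t(1-3), of "\<lambda>s k l. u (e s k l)"]
    have "cscale_matrix (u (e t i j)) (e t i j) = 0"
      by (simp add: matrix_zero_left matrix_zero_right)
    with t unit_neq_zero show False
      by (simp add: cmat.scale_eq_0_iff)
  qed
  then have "cmat.dim alg = card units"
    unfolding alg_def by (rule cmat.dim_span_eq_card_independent)
  also have "\<dots> = card ?S"
    unfolding units_def by (rule card_image[OF inj])
  also have "\<dots> = (\<Sum>t\<in>Ts. (card (I t))\<^sup>2)"
    using finite_types finite_indices by (simp add: card_SigmaI card_cartesian_product power2_eq_square)
  finally show ?thesis .
qed

end

section \<open>Modules over an algebra spanned by matrix units\<close>

lemma hermitian_inner_add_left: "hermitian_inner (u + v) w = hermitian_inner u w + hermitian_inner v w"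
  by (simp add: hermitian_inner_def sum.distrib distrib_right)

lemma hermitian_inner_add_right: "hermitian_inner w (u + v) = hermitian_inner w u + hermitian_inner w v"
  by (simp add: hermitian_inner_def sum.distrib distrib_left)

lemma hermitian_inner_scale_left: "hermitian_inner (c *s u) w = c * hermitian_inner u w"
  by (simp add: hermitian_inner_def sum_distrib_left mult.assoc)

lemma hermitian_inner_scale_right: "hermitian_inner w (c *s u) = cnj c * hermitian_inner w u"
  by (simp add: hermitian_inner_def sum_distrib_left mult_ac)

lemma hermitian_inner_zero_left [simp]: "hermitian_inner 0 w = 0"
  by (simp add: hermitian_inner_def)

lemma hermitian_inner_zero_right [simp]: "hermitian_inner w 0 = 0"
  by (simp add: hermitian_inner_def)

lemma hermitian_inner_diff_left: "hermitian_inner (u - v) w = hermitian_inner u w - hermitian_inner v w"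
  by (simp add: hermitian_inner_def sum_subtractf left_diff_distrib)

lemma hermitian_inner_diff_right: "hermitian_inner w (u - v) = hermitian_inner w u - hermitian_inner w v"
  by (simp add: hermitian_inner_def sum_subtractf right_diff_distrib)

lemmas hermitian_lin = hermitian_inner_add_left hermitian_inner_add_right
  hermitian_inner_diff_left hermitian_inner_diff_right
  hermitian_inner_scale_left hermitian_inner_scale_right

lemma hermitian_inner_span:
  assumes orth: "\<And>a b. \<lbrakk>a \<in> S; b \<in> R\<rbrakk> \<Longrightarrow> hermitian_inner a b = 0"
    and "u \<in> vec.span S" "v \<in> vec.span R"
  shows "hermitian_inner u v = 0"
proof -
  have "vec.span R \<subseteq> {v. hermitian_inner a v = 0}" if "a \<in> S" for a
    by (rule vec.span_minimal) (use that orth in \<open>auto simp: vec.subspace_def hermitian_lin\<close>)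
  then have "S \<subseteq> {u. hermitian_inner u v = 0}"
    using assms(3) by auto
  then have "vec.span S \<subseteq> {u. hermitian_inner u v = 0}"
    by (rule vec.span_minimal) (auto simp: vec.subspace_def hermitian_lin)
  then show ?thesis using assms(2) by auto
qed

lemma hermitian_inner_sum_left: "hermitian_inner (sum f S) w = (\<Sum>i\<in>S. hermitian_inner (f i) w)"
  by (induction S rule: infinite_finite_induct) (simp_all add: hermitian_inner_add_left)

lemma hermitian_inner_commute: "hermitian_inner v u = cnj (hermitian_inner u v)"
  by (simp add: hermitian_inner_def mult.commute)

lemma hermitian_inner_self_eq_0 [simp]: "hermitian_inner v v = 0 \<longleftrightarrow> v = 0"
proof
  assume "hermitian_inner v v = 0"
  moreover have "hermitian_inner v v = complex_of_real (\<Sum>y\<in>UNIV. (cmod (v $ y))\<^sup>2)"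
    unfolding hermitian_inner_def complex_norm_square[symmetric] by simp
  ultimately have "(\<Sum>y\<in>UNIV. (cmod (v $ y))\<^sup>2) = 0"
    by (metis of_real_eq_0_iff)
  then have "\<forall>y\<in>UNIV. (cmod (v $ y))\<^sup>2 = 0"
    by (subst (asm) sum_nonneg_eq_0_iff) auto
  then show "v = 0"
    by (simp add: Finite_Cartesian_Product.vec_eq_iff)
qed simp

lemma orthogonal_family_independent:
  assumes "finite J" and orth: "\<And>i j. \<lbrakk>i \<in> J; j \<in> J; i \<noteq> j\<rbrakk> \<Longrightarrow> hermitian_inner (f i) (f j) = 0"
    and nz: "\<And>i. i \<in> J \<Longrightarrow> f i \<noteq> (0 :: complex ^ 'v::finite)"
  shows "inj_on f J" "vec.independent (f ` J)"
proof -
  show inj: "inj_on f J"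
    by (rule inj_onI) (metis orth nz hermitian_inner_self_eq_0)
  show "vec.independent (f ` J)"
  proof (rule vec.independent_if_scalars_zero)
    fix c w assume *: "(\<Sum>x\<in>f ` J. c x *s x) = 0" "w \<in> f ` J"
    then obtain j where j: "j \<in> J" "w = f j" by auto
    have "0 = hermitian_inner (\<Sum>i\<in>J. c (f i) *s f i) (f j)"
      using * by (simp add: sum.reindex[OF inj])
    also have "\<dots> = (\<Sum>i\<in>J. if i = j then c (f j) * hermitian_inner (f j) (f j) else 0)"
      using orth j by (auto simp: hermitian_inner_sum_left hermitian_inner_scale_left intro!: sum.cong)
    also have "\<dots> = c (f j) * hermitian_inner (f j) (f j)"
      using j \<open>finite J\<close> by simp
    finally show "c w = 0" using nz j by simp
  qed (use \<open>finite J\<close> in simp)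
qed

text \<open>Uniqueness of the summands comes from orthogonality: the differences of two
  decompositions add up to zero, and pairing this sum with its \<open>i\<close>-th term leaves the
  square norm of that term.\<close>

lemma orthogonal_direct_sumI:
  assumes sub: "\<And>i. i < length Ws \<Longrightarrow> vec.subspace (Ws ! i)"
    and orth: "\<And>i j u v. \<lbrakk>i < length Ws; j < length Ws; i \<noteq> j; u \<in> Ws ! i; v \<in> Ws ! j\<rbrakk>
      \<Longrightarrow> hermitian_inner u v = 0"
    and ex: "\<And>v. \<exists>ws. length ws = length Ws \<and> (\<forall>i < length Ws. ws ! i \<in> Ws ! i) \<and> sum_list ws = v"
  shows "orthogonal_direct_sum Ws"
proof -
  have "ws = ws'"
    if ws: "length ws = length Ws" "\<forall>i < length Ws. ws ! i \<in> Ws ! i"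
      and ws': "length ws' = length Ws" "\<forall>i < length Ws. ws' ! i \<in> Ws ! i"
      and eq: "sum_list ws = sum_list ws'" for ws ws'
  proof (rule nth_equalityI)
    fix i assume i: "i < length ws"
    let ?d = "\<lambda>j. ws ! j - ws' ! j"
    have d: "?d j \<in> Ws ! j" if "j < length Ws" for j
      using that ws ws' sub vec.subspace_diff by blast
    have "0 = (\<Sum>j<length Ws. ?d j)"
      using eq ws(1) ws'(1) by (simp add: sum_list_sum_nth sum_subtractf atLeast0LessThan)
    then have "0 = (\<Sum>j<length Ws. hermitian_inner (?d j) (?d i))"
      by (metis hermitian_inner_sum_left hermitian_inner_zero_left)
    also have "\<dots> = (\<Sum>j<length Ws. if j = i then hermitian_inner (?d i) (?d i) else 0)"
      using i ws orth d by (intro sum.cong) auto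
    also have "\<dots> = hermitian_inner (?d i) (?d i)"
      using i ws by simp
    finally show "ws ! i = ws' ! i"
      by simp
  qed (use ws ws' in simp)
  note uniq = this
  have "\<exists>!ws. length ws = length Ws \<and> (\<forall>i < length Ws. ws ! i \<in> Ws ! i) \<and> sum_list ws = v" for v
  proof -
    obtain ws where "length ws = length Ws \<and> (\<forall>i < length Ws. ws ! i \<in> Ws ! i) \<and> sum_list ws = v"
      using ex[of v] by blast
    then show ?thesis
      by (intro ex1I[of _ ws] uniq) simp_all
  qed
  with orth show ?thesis
    unfolding orthogonal_direct_sum_def by blast
qed

section \<open>Cyclic modules, isomorphisms and multiplicities\<close>

context matrix_units
begin

lemma alg_mult: "\<lbrakk>B \<in> alg; C \<in> alg\<rbrakk> \<Longrightarrow> B ** C \<in> alg"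
  using matrix_subalgebra_alg by (simp add: matrix_subalgebra_def)

lemma alg_add: "\<lbrakk>B \<in> alg; C \<in> alg\<rbrakk> \<Longrightarrow> B + C \<in> alg"
  using alg_subspace by (rule cmat.subspace_add)

lemma alg_scale: "B \<in> alg \<Longrightarrow> cscale_matrix c B \<in> alg"
  using alg_subspace by (rule cmat.subspace_scale)

lemma alg_zero: "0 \<in> alg"
  using alg_subspace by (rule cmat.subspace_0)

definition cyclic :: "complex ^ 'v \<Rightarrow> (complex ^ 'v) set" where
  "cyclic v = (\<lambda>B. B *v v) ` alg"

lemma cyclic_module: "alg_module alg (cyclic v)"
  unfolding alg_module_def
proof (intro conjI ballI)
  show "vec.subspace (cyclic v)"
    unfolding vec.subspace_def cyclic_def
    by (auto simp flip: matrix_vector_mult_add_rdistrib cscale_matrix_vector_mult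
        intro!: imageI alg_add alg_scale intro: image_eqI[of _ _ 0] alg_zero)
qed (auto simp: cyclic_def matrix_vector_mul_assoc intro!: imageI alg_mult)

lemma self_in_cyclic: "v \<in> cyclic v"
  unfolding cyclic_def using one_in_alg by (force simp: matrix_vector_mul_lid)

lemma cyclic_minimal: "\<lbrakk>alg_module alg W; v \<in> W\<rbrakk> \<Longrightarrow> cyclic v \<subseteq> W"
  by (auto simp: cyclic_def alg_module_def)

text \<open>The multiplicity space of block \<open>t\<close> without zero, playing the part of
  highest weight vectors: each seed generates an irreducible module, and every irreducible module
  contains one.\<close>

definition seed :: "'t \<Rightarrow> complex ^ 'v \<Rightarrow> bool" where
  "seed t v \<longleftrightarrow> t \<in> Ts \<and> v \<noteq> 0 \<and> e t (root t) (root t) *v v = v"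

lemma unit_vec_mult:
  assumes "t \<in> Ts" "i \<in> I t" "j \<in> I t" "s \<in> Ts" "k \<in> I s" "l \<in> I s"
  shows "e t i j *v (e s k l *v v) = (if t = s \<and> j = k then e t i l *v v else 0)"
  using assms by (simp add: matrix_vector_mul_assoc unit_mult)

lemma vec_expand: "v = (\<Sum>t\<in>Ts. \<Sum>i\<in>I t. e t i i *v v)"
proof -
  have "v = (\<Sum>t\<in>Ts. \<Sum>i\<in>I t. e t i i) *v v"
    by (simp add: unit_sum)
  then show ?thesis by (simp only: matrix_vector_mult_sum_left)
qed

lemma nonzero_component:
  assumes "v \<noteq> 0"
  shows "\<exists>t\<in>Ts. \<exists>i\<in>I t. e t i i *v v \<noteq> 0"
proof (rule ccontr)
  assume "\<not> ?thesis"
  then have "(\<Sum>t\<in>Ts. \<Sum>i\<in>I t. e t i i *v v) = 0"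
    by simp
  with assms vec_expand[of v] show False by simp
qed

text \<open>Write \<open>w = B *v v\<close> and \<open>v = e t (root t) (root t) *v v\<close>; then
  \<open>unit_sandwich\<close> applies. A module generated by a seed thus has one line for each row
  of its block and nothing in the other blocks.\<close>

lemma unit_cyclic:
  assumes "seed t v" "s \<in> Ts" "i \<in> I s" "j \<in> I s" "w \<in> cyclic v"
  shows "\<exists>c. e s i j *v w = (if s = t then c *s (e t i (root t) *v v) else 0)"
proof -
  from assms(5) obtain B where B: "B \<in> alg" "w = B *v v"
    by (auto simp: cyclic_def)
  have t: "t \<in> Ts" "root t \<in> I t" and v: "e t (root t) (root t) *v v = v"
    using assms(1) by (auto simp: seed_def root_index)
  obtain c where c: "e s i j ** B ** e t (root t) (root t)
      = (if s = t then cscale_matrix c (e s i (root t)) else 0)"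
    using unit_sandwich[OF B(1) assms(2-4) t(1,2,2)] by blast
  have "e s i j *v w = (e s i j ** B ** e t (root t) (root t)) *v v"
    unfolding B(2) by (simp add: v flip: matrix_vector_mul_assoc)
  then show ?thesis
    by (auto simp: c cscale_matrix_vector_mult)
qed

lemma cyclic_eq_span:
  assumes "seed t v"
  shows "cyclic v = vec.span ((\<lambda>i. e t i (root t) *v v) ` I t)" (is "_ = vec.span ?S")
proof
  have t: "t \<in> Ts" "root t \<in> I t"
    using assms by (auto simp: seed_def root_index)
  show "cyclic v \<subseteq> vec.span ?S"
  proof
    fix w assume w: "w \<in> cyclic v"
    have "e s i i *v w \<in> vec.span ?S" if s: "s \<in> Ts" "i \<in> I s" for s i
    proof -
      obtain c where "e s i i *v w = (if s = t then c *s (e t i (root t) *v v) else 0)"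
        using unit_cyclic[OF assms s(1,2,2) w] by blast
      then show ?thesis
        using s by (cases "s = t") (simp_all add: vec.span_scale vec.span_base vec.span_zero)
    qed
    then show "w \<in> vec.span ?S"
      by (subst vec_expand[of w]) (auto intro!: vec.span_sum)
  qed
  show "vec.span ?S \<subseteq> cyclic v"
    using cyclic_module[of v] t
    by (intro vec.span_minimal) (auto simp: alg_module_def cyclic_def intro!: imageI unit_in_alg)
qed

lemma seed_basis:
  assumes "seed t v"
  shows "inj_on (\<lambda>i. e t i (root t) *v v) (I t)" "vec.independent ((\<lambda>i. e t i (root t) *v v) ` I t)"
proof -
  let ?f = "\<lambda>i. e t i (root t) *v v"
  have t: "t \<in> Ts" "root t \<in> I t" and v: "v \<noteq> 0" "e t (root t) (root t) *v v = v"
    using assms by (auto simp: seed_def root_index)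
  have proj: "e t (root t) i *v ?f j = (if i = j then v else 0)" if "i \<in> I t" "j \<in> I t" for i j
    using t that v by (simp add: unit_vec_mult)
  show inj: "inj_on ?f (I t)"
    by (rule inj_onI) (metis proj v(1))
  show "vec.independent (?f ` I t)"
  proof (rule vec.independent_if_scalars_zero)
    fix c w assume *: "(\<Sum>x\<in>?f ` I t. c x *s x) = 0" "w \<in> ?f ` I t"
    then obtain i where i: "i \<in> I t" "w = ?f i" by auto
    have "0 = e t (root t) i *v (\<Sum>j\<in>I t. c (?f j) *s ?f j)"
      using * by (simp add: sum.reindex[OF inj])
    also have "\<dots> = (\<Sum>j\<in>I t. if i = j then c (?f j) *s v else 0)"
      unfolding matrix_vector_mult_sum_right
      using i by (intro sum.cong) (auto simp: matrix_vector_mult_scale proj)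
    also have "\<dots> = c w *s v"
      using i finite_indices[OF t(1)] by simp
    finally show "c w = 0" using v by simp
  qed (use finite_indices[OF t(1)] in simp)
qed

text \<open>A nonzero vector of a submodule has a nonzero component in some row of block
  \<open>t\<close>. Moved to the root row it becomes a nonzero multiple of \<open>v\<close>, so the
  submodule contains the generator.\<close>

lemma irreducible_cyclic:
  assumes "seed t v"
  shows "irreducible_module alg (cyclic v)"
  unfolding irreducible_module_def
proof (intro conjI allI impI)
  have t: "t \<in> Ts" "root t \<in> I t" and v: "v \<noteq> 0" "e t (root t) (root t) *v v = v"
    using assms by (auto simp: seed_def root_index)
  show "alg_module alg (cyclic v)" by (rule cyclic_module)
  show "cyclic v \<noteq> {0}" using self_in_cyclic[of v] v by auto
  fix U assume U: "alg_module alg U \<and> U \<subset> cyclic v"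
  show "U = {0}"
  proof (rule ccontr)
    assume "U \<noteq> {0}"
    moreover have "0 \<in> U" using U by (simp add: alg_module_def vec.subspace_0)
    ultimately obtain u where u: "u \<in> U" "u \<noteq> 0" by blast
    then obtain s k where s: "s \<in> Ts" "k \<in> I s" "e s k k *v u \<noteq> 0"
      using nonzero_component by blast
    have uc: "u \<in> cyclic v" using u U by auto
    have "s = t" using unit_cyclic[OF assms s(1,2,2) uc] s(3) by metis
    with s have k: "k \<in> I t" by simp
    obtain c where c: "e t (root t) k *v u = c *s v"
      using unit_cyclic[OF assms t(1,2) k uc] v by auto
    \<comment> \<open>Going back to row \<open>k\<close> gives \<open>e t k k *v u\<close>, which is
      nonzero; hence \<open>c\<close> is not zero.\<close>
    have "e t k (root t) *v (e t (root t) k *v u) \<noteq> 0"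
      using s \<open>s = t\<close> t by (simp add: unit_vec_mult)
    then have "c \<noteq> 0" using c by auto
    have "c *s v \<in> U"
      unfolding c[symmetric] using U u t k unit_in_alg by (auto simp: alg_module_def)
    then have "inverse c *s (c *s v) \<in> U"
      using U vec.subspace_scale unfolding alg_module_def by blast
    then have "v \<in> U" using \<open>c \<noteq> 0\<close> by (simp add: vector_smult_assoc)
    then show False using U cyclic_minimal by blast
  qed
qed

text \<open>A nonzero component of any vector of \<open>U\<close>, moved to the root row, is a seed
  lying in \<open>U\<close>; the module that it generates must be all of \<open>U\<close>.\<close>

lemma irreducible_imp_cyclic:
  assumes "irreducible_module alg U"
  shows "\<exists>t v. seed t v \<and> U = cyclic v"
proof -
  have U: "alg_module alg U" "U \<noteq> {0}" using assms by (auto simp: irreducible_module_def)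
  moreover have "0 \<in> U" using U by (simp add: alg_module_def vec.subspace_0)
  ultimately obtain u where u: "u \<in> U" "u \<noteq> 0" by blast
  then obtain t k where t: "t \<in> Ts" "k \<in> I t" "e t k k *v u \<noteq> 0"
    using nonzero_component by blast
  define v where "v = e t (root t) k *v u"
  have r: "root t \<in> I t" using t root_index by auto
  have "e t k (root t) *v v \<noteq> 0" "e t (root t) (root t) *v v = v"
    using t r by (simp_all add: v_def unit_vec_mult)
  then have "seed t v" using t by (auto simp: seed_def)
  have "v \<in> U" using U u t r unit_in_alg by (auto simp: alg_module_def v_def)
  then have "cyclic v \<subseteq> U" using U cyclic_minimal by auto
  moreover have "cyclic v \<noteq> {0}"
    using self_in_cyclic[of v] \<open>seed t v\<close> by (auto simp: seed_def)
  ultimately have "U = cyclic v"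
    using assms cyclic_module[of v] unfolding irreducible_module_def by blast
  with \<open>seed t v\<close> show ?thesis by blast
qed

text \<open>The coordinate of \<open>e t (root t) i *v w\<close> at a fixed vertex \<open>y\<close> with \<open>v $ y \<noteq> 0\<close> reads off the
  coefficients of \<open>w\<close> with respect to \<open>e t i (root t) *v v\<close>; written as a map on the whole space,
  transporting these coefficients to another seed visibly commutes with the algebra.\<close>

definition transport :: "'t \<Rightarrow> complex ^ 'v \<Rightarrow> complex ^ 'v \<Rightarrow> complex ^ 'v \<Rightarrow> complex ^ 'v" where
  "transport t v v' w = (let y = SOME y. v $ y \<noteq> 0 in
     \<Sum>i\<in>I t. ((e t (root t) i *v w) $ y / v $ y) *s (e t i (root t) *v v'))"

lemma transport_add: "transport t v v' (w + w') = transport t v v' w + transport t v v' w'"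
  by (simp add: transport_def Let_def matrix_vector_right_distrib add_divide_distrib
      vector_sadd_rdistrib sum.distrib)

lemma transport_scale: "transport t v v' (c *s w) = c *s transport t v v' w"
  by (simp add: transport_def Let_def matrix_vector_mult_scale vec.scale_sum_right vector_smult_assoc)

lemma transport_seed:
  assumes "seed t v" "seed t v'"
  shows "transport t v v' v = v'"
proof -
  define y where "y = (SOME y. v $ y \<noteq> 0)"
  have t: "t \<in> Ts" "root t \<in> I t" and v: "v \<noteq> 0" "e t (root t) (root t) *v v = v"
    and v': "e t (root t) (root t) *v v' = v'"
    using assms by (auto simp: seed_def root_index)
  have y: "v $ y \<noteq> 0"
    unfolding y_def by (rule someI_ex) (use v in \<open>auto simp: Finite_Cartesian_Product.vec_eq_iff\<close>)
  have "e t (root t) i *v v = (if i = root t then v else 0)" if "i \<in> I t" for i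
    using unit_vec_mult[OF t(1,2) that t(1,2,2), of v] v by simp
  then have "transport t v v' v
      = (\<Sum>i\<in>I t. if i = root t then e t i (root t) *v v' else 0)"
    unfolding transport_def Let_def y_def[symmetric] using y by (intro sum.cong) auto
  also have "\<dots> = v'"
    using t finite_indices[OF t(1)] v' by simp
  finally show ?thesis .
qed

lemma transport_commute:
  assumes "t \<in> Ts" "B \<in> alg"
  shows "transport t v v' (B *v w) = B *v transport t v v' w"
  using assms(2)
proof (induction rule: alg_induct)
  case zero
  show ?case by (simp add: transport_def)
next
  case (add B C)
  then show ?case by (simp add: matrix_vector_mult_add_rdistrib transport_add)
next
  case (scale c B)
  then show ?case by (simp add: cscale_matrix_vector_mult transport_scale)
next
  case (unit s k l)
  define y where "y = (SOME y. v $ y \<noteq> 0)"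
  define c where "c i = (e t (root t) i *v w) $ y / v $ y" for i
  have r: "root t \<in> I t" using assms root_index by auto
  have "transport t v v' (e s k l *v w)
      = (\<Sum>i\<in>I t. if t = s \<and> i = k then c l *s (e t k (root t) *v v') else 0)"
    unfolding transport_def Let_def y_def[symmetric]
    using unit assms r by (intro sum.cong) (auto simp: unit_vec_mult c_def)
  \<comment> \<open>Both sums have a single term that can be nonzero, with the same value.
    Relabelling it from \<open>k\<close> to \<open>l\<close> makes the sum match the right hand side
    term by term.\<close>
  also have "\<dots> = (\<Sum>i\<in>I t. if t = s \<and> i = l then c l *s (e t k (root t) *v v') else 0)"
    using unit finite_indices[OF assms(1)] by (cases "t = s") auto
  also have "\<dots> = e s k l *v transport t v v' w"
    unfolding transport_def Let_def y_def[symmetric] matrix_vector_mult_sum_right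
    using unit assms r
    by (intro sum.cong) (auto simp: unit_vec_mult c_def matrix_vector_mult_scale)
  finally show ?case .
qed

text \<open>For equal types the two transports are mutually inverse. Conversely, the image of
  \<open>v\<close> is nonzero and still fixed by the root unit of block \<open>t\<close>, whereas
  that unit annihilates a module of another type.\<close>

lemma isomorphic_cyclic_iff:
  assumes "seed t v" "seed s w"
  shows "isomorphic_modules alg (cyclic v) (cyclic w) \<longleftrightarrow> t = s"
proof
  assume "t = s"
  with assms have seeds: "seed t v" "seed t w" and t: "t \<in> Ts" by (auto simp: seed_def)
  have inv: "transport t w' v' (transport t v' w' u) = u" "transport t v' w' u \<in> cyclic w'"
    if s: "seed t v'" "seed t w'" and u: "u \<in> cyclic v'" for v' w' u
  proof -
    from u obtain B where "B \<in> alg" "u = B *v v'" by (auto simp: cyclic_def)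
    with s t show "transport t w' v' (transport t v' w' u) = u" "transport t v' w' u \<in> cyclic w'"
      by (auto simp: transport_commute transport_seed cyclic_def)
  qed
  have "bij_betw (transport t v w) (cyclic v) (cyclic w)"
    by (rule bij_betw_byWitness[where f' = "transport t w v"]) (use inv seeds in auto)
  then show "isomorphic_modules alg (cyclic v) (cyclic w)"
    unfolding isomorphic_modules_def using t
    by (intro exI[of _ "transport t v w"]) (simp add: transport_add transport_scale transport_commute)
next
  assume "isomorphic_modules alg (cyclic v) (cyclic w)"
  then obtain f where bij: "bij_betw f (cyclic v) (cyclic w)"
    and scale: "\<And>c u. u \<in> cyclic v \<Longrightarrow> f (c *s u) = c *s f u"
    and comm: "\<And>B u. \<lbrakk>B \<in> alg; u \<in> cyclic v\<rbrakk> \<Longrightarrow> f (B *v u) = B *v f u"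
    unfolding isomorphic_modules_def by blast
  have t: "t \<in> Ts" "root t \<in> I t" and v: "v \<noteq> 0" "e t (root t) (root t) *v v = v"
    using assms by (auto simp: seed_def root_index)
  have f0: "f 0 = 0" using scale[of v 0] self_in_cyclic[of v] by simp
  have "0 \<in> cyclic v" using cyclic_module[of v] by (simp add: alg_module_def vec.subspace_0)
  then have "f v \<noteq> 0"
    using bij v f0 self_in_cyclic[of v] by (metis bij_betw_def inj_onD)
  moreover have "f v = e t (root t) (root t) *v f v"
    using comm[OF unit_in_alg[OF t(1,2,2)] self_in_cyclic[of v]] v by simp
  moreover have "f v \<in> cyclic w"
    using bij self_in_cyclic[of v] by (auto simp: bij_betw_def)
  ultimately show "t = s"
    using unit_cyclic[OF assms(2) t(1,2,2)] by metis
qed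

definition of_type :: "'t \<Rightarrow> (complex ^ 'v) set \<Rightarrow> bool" where
  "of_type t W \<longleftrightarrow> (\<exists>v. seed t v \<and> W = cyclic v)"

lemma of_type_cyclic: "seed s v \<Longrightarrow> of_type t (cyclic v) \<longleftrightarrow> t = s"
  unfolding of_type_def by (metis isomorphic_cyclic_iff)

text \<open>The right hand side does not mention the decomposition. One seed is taken from each
  summand of type \<open>t\<close>: orthogonality makes them independent, and they span the fixed
  space of the root unit because that unit kills all other summands.\<close>

lemma length_filter_of_type:
  assumes dec: "orthogonal_irreducible_decomposition alg Ws" and t: "t \<in> Ts"
  shows "length (filter (of_type t) Ws) = vec.dim {w. e t (root t) (root t) *v w = w}"
proof -
  define J where "J = {j. j < length Ws \<and> of_type t (Ws ! j)}"
  let ?E = "e t (root t) (root t)"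
  have "\<forall>j\<in>J. \<exists>v. seed t v \<and> Ws ! j = cyclic v"
    by (auto simp: J_def of_type_def)
  then obtain f where f: "\<And>j. j \<in> J \<Longrightarrow> seed t (f j)" "\<And>j. j \<in> J \<Longrightarrow> Ws ! j = cyclic (f j)"
    by metis
  have r: "root t \<in> I t" using t root_index by auto
  have "finite J" by (simp add: J_def)
  have orth: "hermitian_inner (f i) (f j) = 0" if "i \<in> J" "j \<in> J" "i \<noteq> j" for i j
  proof -
    have "f i \<in> Ws ! i" "f j \<in> Ws ! j"
      using that f(2) self_in_cyclic by simp_all
    moreover have "i < length Ws" "j < length Ws"
      using that by (simp_all add: J_def)
    ultimately show ?thesis
      using dec \<open>i \<noteq> j\<close>
      unfolding orthogonal_irreducible_decomposition_def orthogonal_direct_sum_def by blast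
  qed
  have nz: "f j \<noteq> 0" if "j \<in> J" for j
    using f(1)[OF that] by (simp add: seed_def)
  note ind = orthogonal_family_independent[of J f, OF \<open>finite J\<close> orth nz]
  have "vec.span (f ` J) = {w. ?E *v w = w}"
  proof
    show "vec.span (f ` J) \<subseteq> {w. ?E *v w = w}"
    proof (rule vec.span_minimal)
      show "vec.subspace {w. ?E *v w = w}"
        by (simp add: vec.subspace_def matrix_vector_right_distrib matrix_vector_mult_scale)
    qed (use f in \<open>auto simp: seed_def\<close>)
    show "{w. ?E *v w = w} \<subseteq> vec.span (f ` J)"
    proof clarify
      fix w assume w: "?E *v w = w"
      obtain ws where ws: "length ws = length Ws" "\<forall>i < length Ws. ws ! i \<in> Ws ! i" "sum_list ws = w"
        using dec unfolding orthogonal_irreducible_decomposition_def orthogonal_direct_sum_def by metis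
      have "?E *v (ws ! i) \<in> vec.span (f ` J)" if i: "i < length Ws" for i
      proof -
        have "irreducible_module alg (Ws ! i)"
          using dec i by (simp add: orthogonal_irreducible_decomposition_def)
        then obtain s v where s: "seed s v" "Ws ! i = cyclic v"
          using irreducible_imp_cyclic by blast
        have mem: "ws ! i \<in> Ws ! i" using ws i by blast
        \<comment> \<open>A summand of type \<open>t\<close> is mapped into the line of its seed,
          any other summand to zero.\<close>
        show ?thesis
        proof (cases "i \<in> J")
          case True
          have mem': "ws ! i \<in> cyclic (f i)" using mem f(2)[OF True] by simp
          obtain c where "?E *v (ws ! i) = c *s (?E *v f i)"
            using unit_cyclic[OF f(1)[OF True] t r r mem'] by auto
          then show ?thesis
            using f(1)[OF True] True by (simp add: seed_def vec.span_scale vec.span_base)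
        next
          case False
          then have "s \<noteq> t" using i s by (auto simp: J_def of_type_def)
          then show ?thesis
            using unit_cyclic[OF s(1) t r r] mem s by (auto intro: vec.span_zero)
        qed
      qed
      moreover have "w = (\<Sum>i<length Ws. ?E *v (ws ! i))"
        using ws w by (simp add: sum_list_sum_nth atLeast0LessThan flip: matrix_vector_mult_sum_right)
      ultimately show "w \<in> vec.span (f ` J)"
        by (auto intro: vec.span_sum)
    qed
  qed
  then have "vec.dim {w. ?E *v w = w} = card (f ` J)"
    using vec.dim_span_eq_card_independent[OF ind(2)] by simp
  also have "\<dots> = card J" by (rule card_image[OF ind(1)])
  also have "\<dots> = length (filter (of_type t) Ws)"
    by (simp add: length_filter_conv_card J_def)
  finally show ?thesis ..
qed

text \<open>By \<open>length_filter_of_type\<close> every decomposition gives the same count, so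
  inspecting the single decomposition \<open>Ws\<close> is enough.\<close>

lemma has_multiplicity_cyclic:
  assumes "orthogonal_irreducible_decomposition alg Ws" "seed t v"
  shows "has_multiplicity alg (cyclic v) (length (filter (of_type t) Ws))"
proof -
  have "length (filter (isomorphic_modules alg (cyclic v)) Us) = length (filter (of_type t) Ws)"
    if Us: "orthogonal_irreducible_decomposition alg Us" for Us
  proof -
    have "isomorphic_modules alg (cyclic v) U = of_type t U" if "U \<in> set Us" for U
    proof -
      have "irreducible_module alg U"
        using that Us by (simp add: orthogonal_irreducible_decomposition_def)
      then obtain s w where "seed s w" "U = cyclic w"
        using irreducible_imp_cyclic by blast
      then show ?thesis
        using isomorphic_cyclic_iff assms(2) unfolding of_type_def by metis
    qed
    then have "filter (isomorphic_modules alg (cyclic v)) Us = filter (of_type t) Us"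
      by (intro filter_cong) auto
    then show ?thesis
      using length_filter_of_type assms Us by (simp add: seed_def)
  qed
  then show ?thesis
    using assms(1) unfolding has_multiplicity_def by blast
qed

end

section \<open>The Heawood graph\<close>

locale connected_simple_graph =
  fixes adj :: "'v::finite \<Rightarrow> 'v \<Rightarrow> bool"
  assumes simple: "simple_graph adj" and connected: "connected_graph adj"
begin

lemma adj_sym: "adj y z \<longleftrightarrow> adj z y"
  using simple by (auto simp: simple_graph_def dest: sympD)

lemma adj_irrefl: "\<not> adj y y"
  using simple by (auto simp: simple_graph_def irreflp_def)

lemma walk_gdist: "(adj ^^ gdist adj y z) y z"
proof -
  have "\<exists>n. (adj ^^ n) y z"
    using connected rtranclp_imp_relpowp unfolding connected_graph_def by metis
  then show ?thesis unfolding gdist_def by (rule LeastI_ex)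
qed

lemma gdist_le_walk: "(adj ^^ n) y z \<Longrightarrow> gdist adj y z \<le> n"
  unfolding gdist_def by (rule Least_le)

lemma gdist_eq_0_iff [simp]: "gdist adj y z = 0 \<longleftrightarrow> y = z"
  using walk_gdist[of y z] gdist_le_walk[of 0 y z] by (auto simp: relpowp.simps)

lemma gdist_self [simp]: "gdist adj y y = 0"
  by simp

lemma walk_sym: "(adj ^^ n) y z \<Longrightarrow> (adj ^^ n) z y"
proof (induction n arbitrary: z)
  case (Suc n)
  then obtain w where "(adj ^^ n) y w" "adj w z" by (auto elim: relpowp_Suc_E)
  with Suc.IH[of w] show ?case using adj_sym relpowp_Suc_I2 by metis
qed auto

lemma gdist_sym: "gdist adj y z = gdist adj z y"
  by (meson gdist_le_walk le_antisym walk_gdist walk_sym)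

lemma gdist_eq_1_iff: "gdist adj y z = 1 \<longleftrightarrow> adj y z"
proof
  assume "gdist adj y z = 1"
  with walk_gdist[of y z] show "adj y z" by (auto elim: relpowp_Suc_E)
next
  assume a: "adj y z"
  then have "(adj ^^ 1) y z" by (metis relpowp_1)
  then have "gdist adj y z \<le> 1" by (rule gdist_le_walk)
  moreover have "gdist adj y z \<noteq> 0" using a adj_irrefl by auto
  ultimately show "gdist adj y z = 1" by linarith
qed

lemma finite_gdists: "finite {gdist adj y z | y z. True}"
proof (rule finite_subset)
  show "{gdist adj y z | y z. True} \<subseteq> (\<lambda>(y, z). gdist adj y z) ` UNIV" by force
qed simp

lemma gdist_le_diameter: "gdist adj y z \<le> graph_diameter adj"
  unfolding graph_diameter_def using finite_gdists by (rule Max_ge) auto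

end

locale heawood_graph =
  fixes adj :: "'v::finite \<Rightarrow> 'v \<Rightarrow> bool"
  assumes dist_reg: "distance_regular adj"
    and array: "intersection_array adj = ([3, 2, 2], [1, 1, 3])"

sublocale heawood_graph \<subseteq> connected_simple_graph
  using dist_reg by unfold_locales (auto simp: distance_regular_def)

context heawood_graph
begin

lemma diameter: "graph_diameter adj = 3"
proof -
  have "length (fst (intersection_array adj)) = 3"
    by (simp add: array)
  then show ?thesis by (simp add: intersection_array_def)
qed

lemma card_intersection_number:
  assumes "gdist adj y z = h" "i \<le> 3" "j \<le> 3"
  shows "card (dist_sphere adj i y \<inter> dist_sphere adj j z) = intersection_number adj h i j"
proof -
  let ?P = "\<lambda>p. \<forall>y z. gdist adj y z = h \<longrightarrow> card (dist_sphere adj i y \<inter> dist_sphere adj j z) = p"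
  have "h \<le> graph_diameter adj" using gdist_le_diameter assms by metis
  then obtain p where "?P p"
    using dist_reg assms unfolding distance_regular_def diameter by metis
  \<comment> \<open>The definite description is determined because the pair \<open>y\<close>,
    \<open>z\<close> realises the distance \<open>h\<close>; for a distance that does not occur
    every \<open>p\<close> would satisfy \<open>?P\<close>.\<close>
  then have "?P (THE p. ?P p)"
    by (rule theI) (use \<open>?P p\<close> assms in metis)
  then show ?thesis
    using assms unfolding intersection_number_def by blast
qed

text \<open>The intersection numbers \<open>p\<^sup>i\<^sub>1\<^sub>,\<^sub>j\<close>; those with \<open>i = j\<close> vanish because \<open>b\<^sub>i + c\<^sub>i = 3\<close> is the valency.\<close>

definition nbr_count :: "nat \<Rightarrow> nat \<Rightarrow> nat" where
  "nbr_count i j = (if j = Suc i then (if i = 0 then 3 else if i < 3 then 2 else 0)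
     else if i = Suc j then (if i = 3 then 3 else 1) else 0)"

text \<open>The array counts only the neighbours of \<open>y\<close> that are one step closer to
  \<open>x\<close> or one step farther. They already number three, the valency, so they are all the
  neighbours and every other count is zero.\<close>

lemma card_nbrs_sphere: "card {z. adj y z \<and> gdist adj x z = j} = nbr_count (gdist adj x y) j"
proof -
  define i where "i = gdist adj x y"
  let ?N = "\<lambda>j. {z. adj y z \<and> gdist adj x z = j}"
  have i3: "i \<le> 3" and le3: "gdist adj x z \<le> 3" for z
    unfolding i_def using gdist_le_diameter diameter by metis+
  have N: "card (?N j) = intersection_number adj i 1 j" if "j \<le> 3" for j
  proof -
    have "?N j = dist_sphere adj 1 y \<inter> dist_sphere adj j x"
      unfolding dist_sphere_def using gdist_eq_1_iff by auto
    then show ?thesis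
      using card_intersection_number[of y x i 1 j] that by (simp add: i_def gdist_sym[of y])
  qed
  have "map (\<lambda>i. intersection_number adj i 1 (i + 1)) [0..<3] = [3, 2, 2]"
    "map (\<lambda>i. intersection_number adj i 1 (i - 1)) [1..<4] = [1, 1, 3]"
    using array by (auto simp: intersection_array_def diameter)
  then have nums: "intersection_number adj 0 1 1 = 3" "intersection_number adj 1 1 2 = 2"
    "intersection_number adj 2 1 3 = 2" "intersection_number adj 1 1 0 = 1"
    "intersection_number adj 2 1 1 = 1" "intersection_number adj 3 1 2 = 3"
    by (simp_all add: upt_rec numeral_2_eq_2[symmetric])
  have nbr: "card (?N j) = nbr_count i j" if "j = Suc i \<and> i < 3 \<or> i = Suc j" for j
  proof -
    have "j \<le> 3" "i = 0 \<or> i = 1 \<or> i = 2 \<or> i = 3" using that i3 by auto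
    then show ?thesis
      using N[of j] that nums by (auto simp: nbr_count_def numeral_2_eq_2 numeral_3_eq_3)
  qed
  have deg: "card {z. adj y z} = 3"
  proof -
    have "{z. adj y z} = dist_sphere adj 1 y \<inter> dist_sphere adj 1 y"
      unfolding dist_sphere_def using gdist_eq_1_iff by auto
    then show ?thesis
      using card_intersection_number[of y y 0 1 1] nums by simp
  qed
  let ?J = "{j. j = Suc i \<and> i < 3 \<or> i = Suc j}"
  have J: "?J = (if i = 0 then {1} else if i < 3 then {i - 1, Suc i} else {2})"
    using i3 by auto
  have "card (\<Union>j\<in>?J. ?N j) = (\<Sum>j\<in>?J. card (?N j))"
    by (rule card_UN_disjoint) (auto simp: J)
  also have "\<dots> = (\<Sum>j\<in>?J. nbr_count i j)"
    using nbr by (intro sum.cong) auto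
  also have "\<dots> = 3"
    using i3 unfolding J by (auto simp: nbr_count_def)
  finally have "(\<Union>j\<in>?J. ?N j) = {z. adj y z}"
    using deg by (intro card_subset_eq) auto
  then have all: "gdist adj x z \<in> ?J" if "adj y z" for z
    using that by auto
  show ?thesis
  proof (cases "j \<in> ?J")
    case True
    then show ?thesis using nbr i_def by auto
  next
    case False
    then have "?N j = {}" using all by auto
    moreover have "nbr_count i j = 0" using False i3 by (auto simp: nbr_count_def)
    ultimately show ?thesis by (simp add: i_def)
  qed
qed

text \<open>\<open>z\<close> itself is counted by \<open>card_nbrs_sphere\<close>, and
  \<open>nbr_count\<close> vanishes unless the two spheres are consecutive.\<close>

lemma adj_gdist:
  assumes "adj y z"
  shows "gdist adj x z = Suc (gdist adj x y) \<or> gdist adj x y = Suc (gdist adj x z)"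
proof -
  have "card {w. adj y w \<and> gdist adj x w = gdist adj x z} \<noteq> 0"
    using assms by (auto simp: card_eq_0_iff)
  then show ?thesis
    unfolding card_nbrs_sphere by (auto simp: nbr_count_def split: if_splits)
qed

text \<open>By \<open>adj_gdist\<close>, the parity of the distance from \<open>x\<close> changes
  along every edge, so it is a proper 2-colouring and governs the length of every walk.\<close>

lemma even_gdist_iff: "even (gdist adj y z) \<longleftrightarrow> even (gdist adj x y + gdist adj x z)"
proof -
  have "(adj ^^ n) y z \<Longrightarrow> even n \<longleftrightarrow> even (gdist adj x y + gdist adj x z)" for n
  proof (induction n arbitrary: z)
    case (Suc n)
    then obtain w where "(adj ^^ n) y w" "adj w z" by (auto elim: relpowp_Suc_E)
    with Suc.IH[of w] adj_gdist[of w z x] show ?case by auto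
  qed auto
  then show ?thesis using walk_gdist by blast
qed

text \<open>These are the entries of \<open>A^2\<close>. Common neighbours are the neighbours of
  \<open>y\<close> at distance 1 from \<open>z\<close>: 3, 0, 1, 0 of them when the distance of
  \<open>y\<close> and \<open>z\<close> is 0, 1, 2, 3. The base vertex only serves to express the
  colours.\<close>

lemma card_common_nbrs:
  "card {w. adj y w \<and> adj w z} = (if y = z then 2 else 0) + (if even (gdist adj x y + gdist adj x z) then 1 else 0)"
proof -
  have "{w. adj y w \<and> adj w z} = {w. adj y w \<and> gdist adj z w = 1}"
    using gdist_eq_1_iff adj_sym by auto
  then have "card {w. adj y w \<and> adj w z} = nbr_count (gdist adj z y) 1"
    by (simp only: card_nbrs_sphere)
  moreover have "gdist adj z y \<le> 3" using gdist_le_diameter diameter by metis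
  then have "gdist adj z y \<in> {0, 1, 2, 3}"
    by (simp only: insert_iff empty_iff) linarith
  moreover have "gdist adj z y = 0 \<longleftrightarrow> y = z" by auto
  ultimately show ?thesis
    unfolding even_gdist_iff[of y z x, symmetric] gdist_sym[of y z]
    by (auto simp: nbr_count_def)
qed

end

text \<open>Bilinear, without conjugation: the coefficients that multiply the sphere vectors must
  depend linearly on \<open>v\<close>. Against the real vectors \<open>s i\<close> it agrees with
  the Hermitian product (\<open>hermitian_inner_s\<close>).\<close>

definition dot :: "complex ^ 'v::finite \<Rightarrow> complex ^ 'v \<Rightarrow> complex" where
  "dot u v = (\<Sum>y\<in>UNIV. u $ y * v $ y)"

lemma dot_add_left: "dot (u + v) w = dot u w + dot v w"
  by (simp add: dot_def sum.distrib distrib_right)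

lemma dot_scale_left: "dot (c *s u) w = c * dot u w"
  by (simp add: dot_def sum_distrib_left mult.assoc)

lemma dot_add_right: "dot w (u + v) = dot w u + dot w v"
  by (simp add: dot_def sum.distrib distrib_left)

lemma dot_diff_right: "dot w (u - v) = dot w u - dot w v"
  by (simp add: dot_def sum_subtractf right_diff_distrib)

lemma dot_scale_right: "dot w (c *s u) = c * dot w u"
  by (simp add: dot_def sum_distrib_left mult_ac)
locale based_heawood_graph = heawood_graph adj for adj :: "'v::finite \<Rightarrow> 'v \<Rightarrow> bool" +
  fixes x :: 'v
begin

abbreviation A :: "complex ^ 'v ^ 'v" where "A \<equiv> adjacency_matrix adj"
abbreviation D :: "nat \<Rightarrow> complex ^ 'v ^ 'v" where "D \<equiv> dual_idempotent adj x"
abbreviation s :: "nat \<Rightarrow> complex ^ 'v" where "s \<equiv> sphere_vector adj x"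
abbreviation d :: "'v \<Rightarrow> nat" where "d \<equiv> gdist adj x"

lemma d_le: "d y \<le> 3"
  using gdist_le_diameter diameter by metis

lemma d_cases: "d y = 0 \<or> d y = 1 \<or> d y = 2 \<or> d y = 3"
  using d_le[of y] by linarith

lemma A_nth: "(A *v v) $ y = (\<Sum>z | adj y z. v $ z)"
  by (simp add: adjacency_matrix_def matrix_vector_mult_def if_distrib[of "\<lambda>c. c * _"]
      sum.If_cases cong: if_cong)

lemma D_nth: "(D i *v v) $ y = (if d y = i then v $ y else 0)"
proof -
  have "(D i *v v) $ y = (\<Sum>z\<in>UNIV. if z = y then (if d y = i then v $ y else 0) else 0)"
    unfolding dual_idempotent_def matrix_vector_mult_def vec_lambda_beta
    by (intro sum.cong) auto
  then show ?thesis by simp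
qed

lemma s_nth: "s i $ y = (if d y = i then 1 else 0)"
  by (simp add: sphere_vector_def)

lemma dot_s: "dot (s i) v = (\<Sum>y | d y = i. v $ y)"
  by (simp add: dot_def s_nth if_distrib[of "\<lambda>c. c * _"] sum.If_cases cong: if_cong)

lemma A_s_nth: "(A *v s j) $ y = of_nat (nbr_count (d y) j)"
proof -
  have "(A *v s j) $ y = (\<Sum>z | adj y z. if d z = j then 1 else 0)"
    by (simp add: A_nth s_nth)
  also have "\<dots> = of_nat (card {z. adj y z \<and> d z = j})"
    by (simp add: sum.If_cases Int_def)
  finally show ?thesis by (simp only: card_nbrs_sphere)
qed

text \<open>In general \<open>A s_j = b_{j-1} s_{j-1} + c_{j+1} s_{j+1}\<close>; the coefficients
  are the columns of the matrix of type I.\<close>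

lemma A_s: "A *v s 0 = s 1" "A *v s 1 = 3 *s s 0 + s 2"
  "A *v s 2 = 2 *s s 1 + 3 *s s 3" "A *v s 3 = 2 *s s 2"
proof -
  have "(A *v s 0) $ y = s 1 $ y" "(A *v s 1) $ y = (3 *s s 0 + s 2) $ y"
    "(A *v s 2) $ y = (2 *s s 1 + 3 *s s 3) $ y" "(A *v s 3) $ y = (2 *s s 2) $ y" for y
    using d_cases[of y] by (auto simp: A_s_nth s_nth nbr_count_def)
  then show "A *v s 0 = s 1" "A *v s 1 = 3 *s s 0 + s 2"
    "A *v s 2 = 2 *s s 1 + 3 *s s 3" "A *v s 3 = 2 *s s 2"
    by (simp_all add: Finite_Cartesian_Product.vec_eq_iff)
qed

lemma dot_A: "dot u (A *v v) = dot (A *v u) v"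
proof -
  have "dot u (A *v v) = (\<Sum>y\<in>UNIV. \<Sum>z\<in>UNIV. u $ y * (A $ y $ z) * v $ z)"
    by (simp add: dot_def matrix_vector_mult_def sum_distrib_left mult.assoc)
  also have "\<dots> = (\<Sum>z\<in>UNIV. \<Sum>y\<in>UNIV. u $ y * (A $ y $ z) * v $ z)"
    by (rule sum.swap)
  also have "\<dots> = dot (A *v u) v"
  proof -
    have "A $ y $ z = A $ z $ y" for y z
      using adj_sym[of y z] by (simp add: adjacency_matrix_def)
    then show ?thesis
      by (simp add: dot_def matrix_vector_mult_def sum_distrib_left mult_ac)
  qed
  finally show ?thesis .
qed

lemma dot_s_A: "dot (s 0) (A *v v) = dot (s 1) v" "dot (s 1) (A *v v) = 3 * dot (s 0) v + dot (s 2) v"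
  "dot (s 2) (A *v v) = 2 * dot (s 1) v + 3 * dot (s 3) v" "dot (s 3) (A *v v) = 2 * dot (s 2) v"
  by (simp_all only: dot_A A_s dot_add_left dot_scale_left)

lemma dot_s_s_neq: "i \<noteq> j \<Longrightarrow> dot (s i) (s j) = 0"
  by (simp add: dot_s s_nth)

text \<open>These are the sphere sizes, found by counting the edges between consecutive spheres
  twice: \<open>A\<close> moves from one side of \<open>dot\<close> to the other.\<close>

lemma dot_s_s: "dot (s 0) (s 0) = 1" "dot (s 1) (s 1) = 3" "dot (s 2) (s 2) = 6" "dot (s 3) (s 3) = 4"
proof -
  show s0: "dot (s 0) (s 0) = 1"
    by (simp add: dot_s s_nth)
  show s1: "dot (s 1) (s 1) = 3"
    using dot_s_A(2)[of "s 0"] s0 by (simp add: A_s dot_s_s_neq)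
  show s2: "dot (s 2) (s 2) = 6"
    using dot_s_A(3)[of "s 1"] s1 unfolding A_s
    by (simp add: dot_s_s_neq dot_add_right dot_scale_right)
  show "dot (s 3) (s 3) = 4"
    using dot_s_A(4)[of "s 2"] s2 by (simp add: A_s dot_s_s_neq dot_add_right dot_scale_right)
qed

lemma D_s: "D i *v s j = (if i = j then s j else 0)"
  by (auto simp: Finite_Cartesian_Product.vec_eq_iff D_nth s_nth)

lemma D_D: "D i *v (D j *v v) = (if i = j then D i *v v else 0)"
  by (auto simp: Finite_Cartesian_Product.vec_eq_iff D_nth)

lemma dot_s_D: "dot (s i) (D j *v v) = (if i = j then dot (s i) v else 0)"
  by (simp add: dot_s D_nth)

lemma D_sum: "v = D 0 *v v + D 1 *v v + D 2 *v v + D 3 *v v"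
  unfolding Finite_Cartesian_Product.vec_eq_iff
proof
  fix y show "v $ y = (D 0 *v v + D 1 *v v + D 2 *v v + D 3 *v v) $ y"
    using d_cases[of y] by (auto simp: D_nth)
qed

lemma D_0: "D 0 *v v = dot (s 0) v *s s 0"
  by (auto simp: Finite_Cartesian_Product.vec_eq_iff D_nth s_nth dot_s)

lemma D_A_D: "i \<noteq> Suc j \<Longrightarrow> j \<noteq> Suc i \<Longrightarrow> D i *v (A *v (D j *v v)) = 0"
  using adj_gdist[where x = x]
  by (auto simp: Finite_Cartesian_Product.vec_eq_iff D_nth A_nth intro!: sum.neutral) metis

text \<open>The colour classes are unions of spheres about \<open>x\<close>, with indicators
  \<open>s 0 + s 2\<close> and \<open>s 1 + s 3\<close>; hence the part \<open>K\<close> of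
  \<open>A^2\<close> only sees the sphere sums of \<open>v\<close>.\<close>

lemma A_A: "A *v (A *v v) = 2 *s v + (dot (s 0) v + dot (s 2) v) *s (s 0 + s 2)
   + (dot (s 1) v + dot (s 3) v) *s (s 1 + s 3)"
  unfolding Finite_Cartesian_Product.vec_eq_iff
proof
  fix y
  have "(A *v (A *v v)) $ y = (\<Sum>z\<in>UNIV. (\<Sum>w\<in>UNIV. A $ y $ w * A $ w $ z) * v $ z)"
    unfolding matrix_vector_mul_assoc by (simp add: matrix_vector_mult_def matrix_matrix_mult_def)
  also have "\<dots> = (\<Sum>z\<in>UNIV. of_nat (card {w. adj y w \<and> adj w z}) * v $ z)"
  proof (rule sum.cong, simp)
    fix z
    have "(\<Sum>w\<in>UNIV. A $ y $ w * A $ w $ z) = (\<Sum>w\<in>UNIV. if adj y w \<and> adj w z then 1 else 0)"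
      by (intro sum.cong) (auto simp: adjacency_matrix_def)
    then show "(\<Sum>w\<in>UNIV. A $ y $ w * A $ w $ z) * v $ z = of_nat (card {w. adj y w \<and> adj w z}) * v $ z"
      by (simp add: sum.If_cases)
  qed
  also have "\<dots> = (\<Sum>z\<in>UNIV. (if y = z then 2 * v $ y else 0) + (s 0 $ y + s 2 $ y) * (s 0 $ z * v $ z)
      + (s 0 $ y + s 2 $ y) * (s 2 $ z * v $ z)
      + (s 1 $ y + s 3 $ y) * (s 1 $ z * v $ z) + (s 1 $ y + s 3 $ y) * (s 3 $ z * v $ z))"
  proof (rule sum.cong, simp)
    fix z
    show "of_nat (card {w. adj y w \<and> adj w z}) * v $ z = (if y = z then 2 * v $ y else 0)
      + (s 0 $ y + s 2 $ y) * (s 0 $ z * v $ z) + (s 0 $ y + s 2 $ y) * (s 2 $ z * v $ z)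
      + (s 1 $ y + s 3 $ y) * (s 1 $ z * v $ z) + (s 1 $ y + s 3 $ y) * (s 3 $ z * v $ z)"
      unfolding card_common_nbrs[of y z x] s_nth
      using d_cases[of y] d_cases[of z] by auto
  qed
  also have "\<dots> = 2 * v $ y + (s 0 $ y + s 2 $ y) * dot (s 0) v + (s 0 $ y + s 2 $ y) * dot (s 2) v
      + (s 1 $ y + s 3 $ y) * dot (s 1) v + (s 1 $ y + s 3 $ y) * dot (s 3) v"
    by (simp add: sum.distrib sum_distrib_left dot_def)
  also have "\<dots> = (2 *s v + (dot (s 0) v + dot (s 2) v) *s (s 0 + s 2)
      + (dot (s 1) v + dot (s 3) v) *s (s 1 + s 3)) $ y"
    by (simp add: algebra_simps)
  finally show "(A *v (A *v v)) $ y = (2 *s v + (dot (s 0) v + dot (s 2) v) *s (s 0 + s 2)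
      + (dot (s 1) v + dot (s 3) v) *s (s 1 + s 3)) $ y" .
qed

end

section \<open>Matrix units of the Terwilliger algebra\<close>

context based_heawood_graph
begin

lemma D_A: "D 0 *v (A *v w) = dot (s 1) w *s s 0"
  "D 1 *v (A *v w) = dot (s 0) w *s s 1 + D 1 *v (A *v (D 2 *v w))"
  "D 2 *v (A *v w) = D 2 *v (A *v (D 1 *v w)) + D 2 *v (A *v (D 3 *v w))"
  "D 3 *v (A *v w) = D 3 *v (A *v (D 2 *v w))"
proof -
  have *: "D i *v (A *v w) = D i *v (A *v (D 0 *v w)) + D i *v (A *v (D 1 *v w))
      + D i *v (A *v (D 2 *v w)) + D i *v (A *v (D 3 *v w))" for i
    by (subst D_sum[of w]) (simp only: matrix_vector_right_distrib)
  show "D 0 *v (A *v w) = dot (s 1) w *s s 0"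
    by (simp only: D_0 dot_s_A)
  show "D 1 *v (A *v w) = dot (s 0) w *s s 1 + D 1 *v (A *v (D 2 *v w))"
    by (subst *) (simp add: D_A_D D_0 matrix_vector_mult_scale A_s D_s)
  show "D 2 *v (A *v w) = D 2 *v (A *v (D 1 *v w)) + D 2 *v (A *v (D 3 *v w))"
    by (subst *) (simp add: D_A_D)
  show "D 3 *v (A *v w) = D 3 *v (A *v (D 2 *v w))"
    by (subst *) (simp add: D_A_D)
qed

lemmas vec_lin = matrix_vector_right_distrib matrix_vector_mult_diff_distrib matrix_vector_mult_scale
lemmas dot_lin = dot_add_right dot_diff_right dot_scale_right

text \<open>A walk of two steps ending in sphere 1 passes through \<open>x\<close> or through sphere
  2. The formula is \<open>A_A\<close> with the walks through \<open>x\<close> subtracted, which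
  removes the interaction of different vertices of sphere 1.\<close>

lemma D1_A_D2_A: "D 1 *v (A *v (D 2 *v (A *v w))) = 2 *s (D 1 *v w) + dot (s 3) w *s s 1"
proof -
  have "D 1 *v (A *v (D 2 *v (A *v w))) = D 1 *v (A *v (A *v w)) - dot (s 1) w *s s 1"
    using D_A(2)[of "A *v w"] by (simp add: dot_s_A)
  also have "\<dots> = 2 *s (D 1 *v w) + dot (s 3) w *s s 1"
    by (simp add: A_A vec_lin D_s vector_sadd_rdistrib)
  finally show ?thesis .
qed

text \<open>All neighbours of sphere 3 lie in sphere 2, so this is the sphere 3 part of
  \<open>A^2\<close> without correction.\<close>

lemma D3_A_D2_A: "D 3 *v (A *v (D 2 *v (A *v w))) = 2 *s (D 3 *v w) + (dot (s 1) w + dot (s 3) w) *s s 3"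
  unfolding D_A(4)[symmetric] by (simp add: A_A vec_lin D_s)

definition outer :: "nat \<Rightarrow> nat \<Rightarrow> complex ^ 'v ^ 'v" where
  "outer i j = (\<chi> y z. s i $ y * s j $ z)"

lemma outer_mult: "outer i j *v v = dot (s j) v *s s i"
  by (simp add: outer_def matrix_vector_mult_def dot_def Finite_Cartesian_Product.vec_eq_iff
      sum_distrib_left mult_ac)

text \<open>\<open>F t\<close> projects onto the vectors in \<open>\<Gamma>\<^sub>t\<close> that generate modules of endpoint \<open>t\<close>.\<close>

definition F :: "nat \<Rightarrow> complex ^ 'v ^ 'v" where
  "F t = (if t = 1 then D 1 - cscale_matrix (1/3) (outer 1 1)
          else D 2 - cscale_matrix (1/2) (D 2 ** A ** D 1 ** A ** D 2))"

lemma F1: "F 1 *v v = D 1 *v v - (dot (s 1) v / 3) *s s 1"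
  by (simp add: F_def matrix_vector_mult_diff_rdistrib cscale_matrix_vector_mult outer_mult
      vector_smult_assoc)

lemma F2: "F 2 *v v = D 2 *v v - (1/2) *s (D 2 *v (A *v (D 1 *v (A *v (D 2 *v v)))))"
  by (simp add: F_def matrix_vector_mult_diff_rdistrib cscale_matrix_vector_mult
      flip: matrix_vector_mul_assoc)

text \<open>For \<open>t = 2\<close> the factor 1/2 balances: the sum of
  \<open>D 2 A D 1 A D 2 v\<close> over sphere 2 is twice that of \<open>v\<close>, as each vertex
  of sphere 1 has two neighbours there. Consequently \<open>A_A\<close> reduces to multiplication by
  2 on the range of \<open>F t\<close>.\<close>

lemma dot_s_F:
  assumes "t \<in> {1, 2}" "i \<le> 3"
  shows "dot (s i) (F t *v v) = 0"
proof -
  have "dot (s i) (F 1 *v v) = 0"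
    by (cases "i = 1") (simp_all add: F1 dot_lin dot_s_D dot_s_s dot_s_s_neq del: One_nat_def)
  moreover have "dot (s i) (F 2 *v v) = 0"
    by (cases "i = 2") (simp_all add: F2 dot_lin dot_s_D dot_s_A del: One_nat_def)
  ultimately show ?thesis using assms by auto
qed

lemma dot_s_A_F:
  assumes "t \<in> {1, 2}" "i \<le> 3"
  shows "dot (s i) (A *v (F t *v v)) = 0"
proof -
  have "i = 0 \<or> i = 1 \<or> i = 2 \<or> i = 3" using assms by linarith
  then show ?thesis
    using dot_s_F[OF assms(1)] by (auto simp: dot_s_A simp del: One_nat_def)
qed

lemma F_s:
  assumes "t \<in> {1, 2}" "i \<le> 3"
  shows "F t *v s i = 0"
proof -
  have "F 1 *v s i = 0"
    by (cases "i = 1") (simp_all add: F1 D_s dot_s_s dot_s_s_neq del: One_nat_def)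
  moreover have "F 2 *v s i = 0"
    by (cases "i = 2") (simp_all add: F2 D_s A_s vec_lin vector_smult_assoc del: One_nat_def)
  ultimately show ?thesis using assms by auto
qed

lemma F_A_s:
  assumes "t \<in> {1, 2}" "i \<le> 3"
  shows "F t *v (A *v s i) = 0"
proof -
  have "i = 0 \<or> i = 1 \<or> i = 2 \<or> i = 3" using assms by linarith
  then show ?thesis
    using F_s[OF assms(1)] by (auto simp: A_s vec_lin simp del: One_nat_def)
qed

lemma A_A_F: "t \<in> {1, 2} \<Longrightarrow> A *v (A *v (F t *v v)) = 2 *s (F t *v v)"
  by (simp only: A_A dot_s_F) simp

lemma D_F:
  assumes "t \<in> {1, 2}"
  shows "D i *v (F t *v v) = (if i = t then F t *v v else 0)"
proof -
  have "D i *v (F 1 *v v) = (if i = 1 then F 1 *v v else 0)"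
    by (simp add: F1 vec_lin D_D D_s del: One_nat_def)
  moreover have "D i *v (F 2 *v v) = (if i = 2 then F 2 *v v else 0)"
    by (simp add: F2 vec_lin D_D del: One_nat_def)
  ultimately show ?thesis using assms by auto
qed

lemma F_D:
  assumes "t \<in> {1, 2}"
  shows "F t *v (D i *v v) = (if i = t then F t *v v else 0)"
proof -
  have "F 1 *v (D i *v v) = (if i = 1 then F 1 *v v else 0)"
    by (simp add: F1 dot_s_D D_D del: One_nat_def)
  moreover have "F 2 *v (D i *v v) = (if i = 2 then F 2 *v v else 0)"
    by (simp add: F2 D_D del: One_nat_def)
  ultimately show ?thesis using assms by auto
qed

text \<open>With \<open>u = D 1 A D 2 v\<close>, lifting \<open>u\<close> to sphere 2 and lowering
  it again gives \<open>2 u\<close> by \<open>D1_A_D2_A\<close>, so the subtracted half cancels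
  \<open>u\<close> exactly.\<close>

lemma D1_A_F2: "D 1 *v (A *v (F 2 *v v)) = 0"
  using D1_A_D2_A[of "D 1 *v (A *v (D 2 *v v))"]
  by (simp add: F2 vec_lin D_D dot_s_D vector_smult_assoc del: One_nat_def)

text \<open>Only the spheres \<open>t - 1\<close> and \<open>t + 1\<close> can be reached. The lower
  one is excluded by orthogonality to \<open>s 1\<close> when \<open>t = 1\<close> and by
  \<open>D1_A_F2\<close> when \<open>t = 2\<close>.\<close>

lemma A_F:
  assumes "t \<in> {1, 2}"
  shows "D i *v (A *v (F t *v v)) = (if i = Suc t then A *v (F t *v v) else 0)"
proof -
  have 0: "D 0 *v (A *v (F t *v v)) = 0"
    using dot_s_F[OF assms] by (simp add: D_A del: One_nat_def)
  have 2: "D i *v (A *v (F t *v v)) = 0" if "i \<noteq> Suc t" "t \<noteq> Suc i" for i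
    using D_A_D[of i t "F t *v v"] that assms by (simp add: D_F)
  have 1: "D 1 *v (A *v (F t *v v)) = 0"
    using assms D1_A_F2 2[of 1] by (auto simp del: One_nat_def)
  have *: "D i *v (A *v (F t *v v)) = 0" if "i \<noteq> Suc t" for i
    using 0 1 2[of i] that assms by (cases "t = Suc i") auto
  moreover have "A *v (F t *v v) = D (Suc t) *v (A *v (F t *v v))"
    by (subst D_sum) (use * assms in \<open>auto simp: numeral_2_eq_2 numeral_3_eq_3\<close>)
  ultimately show ?thesis by metis
qed

lemma F_F:
  assumes "t \<in> {1, 2}" "r \<in> {1, 2}"
  shows "F t *v (F r *v v) = (if t = r then F t *v v else 0)"
proof -
  have "F t *v (F r *v v) = F t *v (D r *v (F r *v v))"
    using assms by (simp add: D_F)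
  also have "\<dots> = (if t = r then F t *v (F t *v v) else 0)"
    using assms by (simp add: F_D)
  also have "F 1 *v (F 1 *v v) = F 1 *v v"
    by (subst F1) (simp add: D_F dot_s_F del: One_nat_def)
  moreover have "F 2 *v (F 2 *v v) = F 2 *v v"
    by (subst F2) (simp add: D_F A_F del: One_nat_def)
  ultimately show ?thesis using assms by auto
qed

text \<open>\<open>A F 1 v\<close> lies in the part of sphere 2 that \<open>F 2\<close> removes:
  lowering it returns \<open>2 F 1 v\<close>, and half the lift of this is \<open>A F 1 v\<close>
  again.\<close>

lemma F2_A_F1: "F 2 *v (A *v (F 1 *v v)) = 0"
proof -
  have 1: "D 1 *v (A *v (A *v (F 1 *v v))) = 2 *s (F 1 *v v)"
    by (simp add: A_A_F vec_lin D_F del: One_nat_def)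
  have 2: "D 2 *v (A *v (F 1 *v v)) = A *v (F 1 *v v)"
    by (simp add: A_F)
  show ?thesis
    unfolding F2 2 1 by (simp add: vec_lin 2 vector_smult_assoc del: One_nat_def)
qed

lemma F_A_F:
  assumes "t \<in> {1, 2}" "r \<in> {1, 2}"
  shows "F t *v (A *v (F r *v v)) = 0"
proof (cases "t = 2 \<and> r = 1")
  case True
  then show ?thesis using F2_A_F1 by simp
next
  case False
  then have "t \<noteq> Suc r" using assms by auto
  then have "F t *v (D t *v (A *v (F r *v v))) = 0"
    using assms by (simp add: A_F)
  then show ?thesis using assms by (simp add: F_D)
qed

text \<open>Half of this is the diagonal unit of type 1 in sphere 2. It contains the very term that
  \<open>F 2\<close> subtracts, so the two cancel in \<open>e_sum_vec\<close>.\<close>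

lemma A_F1_A: "A *v (F 1 *v (A *v v))
   = D 2 *v (A *v (D 1 *v (A *v (D 2 *v v)))) - (dot (s 2) v / 3) *s s 2"
proof -
  have "A *v (F 1 *v (A *v v)) = D 2 *v (A *v (F 1 *v (A *v v)))"
    by (simp add: A_F)
  also have "\<dots> = D 2 *v (A *v (D 1 *v (A *v v))) - (dot (s 0) v + dot (s 2) v / 3) *s s 2"
    by (simp add: F1 vec_lin dot_s_A A_s D_s vector_smult_assoc add_divide_distrib del: One_nat_def)
  also have "D 2 *v (A *v (D 1 *v (A *v v)))
      = D 2 *v (A *v (D 1 *v (A *v (D 2 *v v)))) + dot (s 0) v *s s 2"
    by (subst D_A(2)) (simp add: vec_lin A_s D_s del: One_nat_def)
  finally show ?thesis
    by (simp add: vector_sadd_rdistrib)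
qed

text \<open>Half of this is the identity of sphere 3 minus the projection onto \<open>s 3\<close>:
  apart from the line of \<open>s 3\<close>, modules of endpoint 2 fill the sphere.\<close>

lemma A_F2_A: "A *v (F 2 *v (A *v v)) = 2 *s (D 3 *v v) - (dot (s 3) v / 2) *s s 3"
proof -
  have *: "F 2 *v (A *v v)
      = D 2 *v (A *v v) - D 2 *v (A *v (D 1 *v v)) - (dot (s 3) v / 2) *s s 2"
    unfolding F2 D1_A_D2_A
    by (simp add: vec_lin A_s D_s vector_smult_assoc vector_add_ldistrib del: One_nat_def)
  have "A *v (F 2 *v (A *v v)) = D 3 *v (A *v (F 2 *v (A *v v)))"
    by (simp add: A_F)
  also have "\<dots> = 2 *s (D 3 *v v) - (dot (s 3) v / 2) *s s 3"
    unfolding *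
    by (simp add: vec_lin D3_A_D2_A A_s D_s D_D dot_s_D vector_smult_assoc del: One_nat_def)
       (simp add: Finite_Cartesian_Product.vec_eq_iff algebra_simps)
  finally show ?thesis .
qed

text \<open>Block 0 sends \<open>s j\<close> to \<open>s i\<close>, hence the division by the square
  norm. In the other blocks \<open>A\<close> lifts from sphere \<open>t\<close> to the next and
  \<open>(1/2) A\<close> leads back, since \<open>A^2\<close> is 2 there. With this unsymmetric
  scaling, column \<open>t\<close> applied to a seed gives precisely the listed bases.\<close>

definition e :: "nat \<Rightarrow> nat \<Rightarrow> nat \<Rightarrow> complex ^ 'v ^ 'v" where
  "e t i j = (if t = 0 then cscale_matrix (1 / dot (s j) (s j)) (outer i j)
     else (if i = t then Finite_Cartesian_Product.mat 1 else A) ** F t **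
          (if j = t then Finite_Cartesian_Product.mat 1 else cscale_matrix (1/2) A))"

text \<open>The rows of a block are labelled by the spheres that its modules meet; the smallest
  label \<open>t\<close> is the endpoint.\<close>

definition I :: "nat \<Rightarrow> nat set" where
  "I t = {t..if t = 1 then 2 else 3}"

lemma e_0: "e 0 i j *v v = (dot (s j) v / dot (s j) (s j)) *s s i"
  by (simp add: e_def cscale_matrix_vector_mult outer_mult vector_smult_assoc)

lemma e_pos: "t > 0 \<Longrightarrow> e t i j *v v = (let w = F t *v (if j = t then v else (1/2) *s (A *v v))
    in if i = t then w else A *v w)"
  by (simp add: e_def cscale_matrix_vector_mult Let_def flip: matrix_vector_mul_assoc)

lemma I_0: "i \<in> I 0 \<longleftrightarrow> i \<le> 3"
  by (simp add: I_def)

lemma I_pos: "t \<in> {1, 2} \<Longrightarrow> i \<in> I t \<longleftrightarrow> i = t \<or> i = Suc t"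
  by (auto simp: I_def)

lemma dot_s_s_nz: "i \<le> 3 \<Longrightarrow> dot (s i) (s i) \<noteq> 0"
proof -
  assume "i \<le> 3"
  then have "i = 0 \<or> i = 1 \<or> i = 2 \<or> i = 3" by linarith
  then show ?thesis using dot_s_s by auto
qed

lemma e_mult:
  assumes t: "t \<in> {0, 1, 2}" "i \<in> I t" "j \<in> I t" and r: "r \<in> {0, 1, 2}" "k \<in> I r" "l \<in> I r"
  shows "e t i j ** e r k l = (if t = r \<and> j = k then e t i l else 0)"
proof -
  have "e t i j *v (e r k l *v v) = (if t = r \<and> j = k then e t i l *v v else 0)" for v
  proof -
    consider "t = 0" "r = 0" | "t = 0" "r \<in> {1, 2}" | "t \<in> {1, 2}" "r = 0" | "t \<in> {1, 2}" "r \<in> {1, 2}"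
      using t r by auto
    then show ?thesis
    proof cases
      case 1
      with t r show ?thesis
        by (cases "j = k") (simp_all add: e_0 dot_scale_right dot_s_s_nz dot_s_s_neq I_0)
    next
      case 2
      with t have "j \<le> 3" "r > 0" by (auto simp: I_0)
      with 2 show ?thesis
        by (simp add: e_0 e_pos Let_def dot_s_F dot_s_A_F)
    next
      case 3
      with r have "k \<le> 3" "t > 0" by (auto simp: I_0)
      with 3 show ?thesis
        by (simp add: e_0 e_pos Let_def vec_lin F_s F_A_s)
    next
      case 4
      with t r have "t > 0" "r > 0" "j = t \<or> j = Suc t" "k = r \<or> k = Suc r"
        by (auto simp: I_pos)
      with 4 show ?thesis
        by (auto simp: e_pos Let_def vec_lin F_F F_A_F A_A_F vector_smult_assoc simp del: One_nat_def)
    qed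
  qed
  then show ?thesis
    by (auto simp: Finite_Cartesian_Product.matrix_eq simp flip: matrix_vector_mul_assoc)
qed

lemma I_sum: "(\<Sum>i\<in>I 0. f i) = f 0 + f 1 + f 2 + f 3" "(\<Sum>i\<in>I 1. f i) = f 1 + f 2"
  "(\<Sum>i\<in>I 2. f i) = f 2 + f 3" for f :: "nat \<Rightarrow> 'z::comm_monoid_add"
proof -
  have "I 0 = {0, 1, 2, 3}" "I 1 = {1, 2}" "I 2 = {2, 3}" by (auto simp: I_def)
  then show "(\<Sum>i\<in>I 0. f i) = f 0 + f 1 + f 2 + f 3" "(\<Sum>i\<in>I 1. f i) = f 1 + f 2"
    "(\<Sum>i\<in>I 2. f i) = f 2 + f 3" by (simp_all add: add.assoc)
qed

text \<open>Sphere by sphere: sphere 1 consists of \<open>s 1\<close> and type 1, sphere 2 of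
  \<open>s 2\<close> and both other types, sphere 3 of \<open>s 3\<close> and type 2.\<close>

lemma e_sum_vec: "v = (e 0 0 0 *v v + e 0 1 1 *v v + e 0 2 2 *v v + e 0 3 3 *v v)
    + (e 1 1 1 *v v + e 1 2 2 *v v) + (e 2 2 2 *v v + e 2 3 3 *v v)"
proof -
  define a where "a = D 2 *v (A *v (D 1 *v (A *v (D 2 *v v))))"
  have 1: "e 1 1 1 *v v = D 1 *v v - (dot (s 1) v / 3) *s s 1" "e 2 2 2 *v v = D 2 *v v - (1/2) *s a"
    unfolding a_def F1[symmetric] F2[symmetric] by (simp_all add: e_pos)
  have 2: "e 1 2 2 *v v = (1/2) *s (a - (dot (s 2) v / 3) *s s 2)"
    "e 2 3 3 *v v = (1/2) *s (2 *s (D 3 *v v) - (dot (s 3) v / 2) *s s 3)"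
    unfolding a_def A_F1_A[symmetric] A_F2_A[symmetric] by (simp_all add: e_pos matrix_vector_mult_scale)
  show ?thesis
    unfolding e_0 dot_s_s 1 2
    by (subst D_sum[of v]) (simp add: D_0 Finite_Cartesian_Product.vec_eq_iff field_simps)
qed

lemma e_sum: "(\<Sum>t\<in>{0, 1, 2}. \<Sum>i\<in>I t. e t i i) = Finite_Cartesian_Product.mat 1"
  unfolding Finite_Cartesian_Product.matrix_eq
  using e_sum_vec by (simp add: I_sum matrix_vector_mult_add_rdistrib add.assoc del: One_nat_def)

definition types :: "nat set" where "types = {0, 1, 2}"

lemma types_mem: "0 \<in> types" "1 \<in> types" "2 \<in> types"
  by (simp_all add: types_def)

section \<open>Adjoints of the matrix units and their products with the generators\<close>

lemma A_self_adjoint: "hermitian_inner (A *v u) v = hermitian_inner u (A *v v)"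
proof -
  define w where "w = (\<chi> y. cnj (v $ y))"
  have "A *v w = (\<chi> y. cnj ((A *v v) $ y))"
    by (simp add: w_def Finite_Cartesian_Product.vec_eq_iff A_nth)
  then show ?thesis
    using dot_A[of u w] by (simp add: w_def dot_def hermitian_inner_def)
qed

lemma D_self_adjoint: "hermitian_inner (D i *v u) v = hermitian_inner u (D i *v v)"
  by (auto simp: hermitian_inner_def D_nth intro!: sum.cong)

lemma hermitian_inner_s: "hermitian_inner u (s i) = dot (s i) u" "hermitian_inner (s i) u = cnj (dot (s i) u)"
  by (simp_all add: hermitian_inner_def dot_def s_nth if_distrib[of cnj] mult.commute
      if_distrib[of "\<lambda>c. c * _"] cong: if_cong)

lemma F_self_adjoint:
  assumes "t \<in> {1, 2}"
  shows "hermitian_inner (F t *v u) v = hermitian_inner u (F t *v v)"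
proof -
  have "hermitian_inner (F 1 *v u) v = hermitian_inner u (F 1 *v v)"
    by (simp add: F1 hermitian_lin hermitian_inner_s D_self_adjoint del: One_nat_def)
  moreover have "hermitian_inner (F 2 *v u) v = hermitian_inner u (F 2 *v v)"
    by (simp add: F2 hermitian_lin D_self_adjoint A_self_adjoint del: One_nat_def)
  ultimately show ?thesis using assms by auto
qed

lemma cnj_dot_s_s: "cnj (dot (s i) (s i)) = dot (s i) (s i)"
  by (simp add: dot_def s_nth if_distrib[of cnj] cong: if_cong)

text \<open>The row vectors are orthogonal but not normalised, so transposing a unit costs the ratio
  of square norms: sphere sizes in block 0, a factor 2 for each \<open>A\<close> otherwise.\<close>

lemma e_adjoint:
  assumes "t \<in> types" "i \<in> I t" "j \<in> I t"
  shows "\<exists>c. \<forall>u v. hermitian_inner (e t i j *v u) v = c * hermitian_inner u (e t j i *v v)"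
proof (cases "t = 0")
  case True
  with assms have "dot (s i) (s i) \<noteq> 0" by (simp add: I_0 dot_s_s_nz)
  with True show ?thesis
    by (intro exI[of _ "dot (s i) (s i) / dot (s j) (s j)"])
      (simp add: e_0 hermitian_lin hermitian_inner_s cnj_dot_s_s)
next
  case False
  with assms have "t \<in> {1, 2}" "t > 0" by (auto simp: types_def)
  then show ?thesis
    by (intro exI[of _ "(if i = t then 1 else 2) / (if j = t then 1 else 2)"])
      (simp add: e_pos Let_def hermitian_lin A_self_adjoint F_self_adjoint vec_lin)
qed

lemma D_e:
  assumes "t \<in> types" "i \<in> I t" "j \<in> I t"
  shows "D k *v (e t i j *v v) = (if k = i then e t i j *v v else 0)"
proof (cases "t = 0")
  case True
  then show ?thesis by (auto simp: e_0 vec_lin D_s)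
next
  case False
  with assms have "t \<in> {1, 2}" "t > 0" by (auto simp: types_def)
  with assms show ?thesis
    by (auto simp: e_pos Let_def D_F A_F I_pos)
qed

text \<open>\<open>A\<close> changes only the row. It is tridiagonal with zero diagonal on the
  spheres and exchanges the two rows of the other blocks, so two terms always suffice; a missing one
  is padded with coefficient 0.\<close>

lemma A_e:
  assumes "t \<in> types" "i \<in> I t" "j \<in> I t"
  shows "\<exists>a b k l. k \<in> I t \<and> l \<in> I t \<and> (\<forall>v. A *v (e t i j *v v) = a *s (e t k j *v v) + b *s (e t l j *v v))"
proof (cases "t = 0")
  case True
  have "i = 0 \<or> i = 1 \<or> i = 2 \<or> i = 3" using assms True by (simp add: I_0) linarith
  then have "\<exists>a b k l. k \<le> 3 \<and> l \<le> 3 \<and> A *v s i = a *s s k + b *s s l"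
  proof (elim disjE)
    show ?thesis if "i = 0"
      by (rule exI[of _ 1], rule exI[of _ 0], rule exI[of _ 1], rule exI[of _ 0]) (simp add: that A_s)
    show ?thesis if "i = 1"
      by (rule exI[of _ 3], rule exI[of _ 1], rule exI[of _ 0], rule exI[of _ 2]) (simp add: that A_s del: One_nat_def)
    show ?thesis if "i = 2"
      by (rule exI[of _ 2], rule exI[of _ 3], rule exI[of _ 1], rule exI[of _ 3]) (simp add: that A_s)
    show ?thesis if "i = 3"
      by (rule exI[of _ 2], rule exI[of _ 0], rule exI[of _ 2], rule exI[of _ 0]) (simp add: that A_s)
  qed
  then obtain a b k l where "k \<le> 3" "l \<le> 3" "A *v s i = a *s s k + b *s s l"
    by blast
  then have "k \<in> I t \<and> l \<in> I t \<and> (\<forall>v. A *v (e t i j *v v) = a *s (e t k j *v v) + b *s (e t l j *v v))"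
    using True by (simp add: I_0 e_0 vec_lin vector_smult_assoc vector_add_ldistrib mult.commute)
  then show ?thesis by blast
next
  case False
  with assms have t: "t \<in> {1, 2}" "t > 0" by (auto simp: types_def)
  have I: "t \<in> I t" "Suc t \<in> I t" using t by (simp_all add: I_pos)
  show ?thesis
  proof (cases "i = t")
    case True
    with t have "A *v (e t i j *v v) = 1 *s (e t (Suc t) j *v v) + 0 *s (e t t j *v v)" for v
      by (simp add: e_pos Let_def)
    then show ?thesis using I by blast
  next
    case False
    with t assms have "A *v (e t i j *v v) = 2 *s (e t t j *v v) + 0 *s (e t t j *v v)" for v
      by (simp add: e_pos Let_def A_A_F del: insert_iff)
    then show ?thesis using I by blast
  qed
qed

text \<open>The rank one matrices grow from \<open>D 0\<close> by one sphere at a time, on the left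
  for rows and on the right for columns. The factor 1/3 undoes \<open>c_3 = 3\<close>.\<close>

lemma outer_steps: "outer 0 0 = D 0"
  "outer 1 j = D 1 ** A ** outer 0 j" "outer 2 j = D 2 ** A ** outer 1 j"
  "outer 3 j = cscale_matrix (1/3) (D 3 ** A ** outer 2 j)"
  "outer i 1 = outer i 0 ** A ** D 1" "outer i 2 = outer i 1 ** A ** D 2"
  "outer i 3 = cscale_matrix (1/3) (outer i 2 ** A ** D 3)"
  by (simp_all add: Finite_Cartesian_Product.matrix_eq outer_mult D_0 vec_lin A_s D_s dot_s_A dot_s_D
      cscale_matrix_vector_mult vector_smult_assoc del: One_nat_def flip: matrix_vector_mul_assoc)

text \<open>This gives the lower bound for the Terwilliger algebra: no subalgebra containing its
  generators can miss a matrix unit.\<close>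

lemma e_in_subalgebra:
  assumes S: "matrix_subalgebra S" "A \<in> S" "\<And>i. i \<le> 3 \<Longrightarrow> D i \<in> S"
    and t: "t \<in> types" "i \<in> I t" "j \<in> I t"
  shows "e t i j \<in> S"
proof -
  have mult: "M ** N \<in> S" if "M \<in> S" "N \<in> S" for M N
    using S that by (simp add: matrix_subalgebra_def)
  have sub: "cmat.subspace S" "Finite_Cartesian_Product.mat 1 \<in> S"
    using S by (simp_all add: matrix_subalgebra_def)
  note scale = cmat.subspace_scale[OF sub(1)] and diff = cmat.subspace_diff[OF sub(1)]
  have D: "D 0 \<in> S" "D 1 \<in> S" "D 2 \<in> S" "D 3 \<in> S"
    using S by simp_all
  have o0: "outer 0 0 \<in> S"
    unfolding outer_steps(1) by (rule D)
  have o1: "outer 1 0 \<in> S"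
    unfolding outer_steps(2) by (intro mult D S(2) o0)
  have o2: "outer 2 0 \<in> S"
    unfolding outer_steps(3) by (intro mult D S(2) o1)
  have o3: "outer 3 0 \<in> S"
    unfolding outer_steps(4) by (intro scale mult D S(2) o2)
  have row: "outer i j \<in> S" if "outer i 0 \<in> S" "j \<in> {0, 1, 2, 3}" for i j
  proof -
    have "outer i 1 \<in> S"
      unfolding outer_steps(5) by (intro mult D S(2) that)
    moreover from this have "outer i 2 \<in> S"
      unfolding outer_steps(6) by (intro mult D S(2))
    moreover from this have "outer i 3 \<in> S"
      unfolding outer_steps(7) by (intro scale mult D S(2))
    ultimately show ?thesis using that by auto
  qed
  have outer: "outer i j \<in> S" if "i \<in> {0, 1, 2, 3}" "j \<in> {0, 1, 2, 3}" for i j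
    using that(1) row[OF o0 that(2)] row[OF o1 that(2)] row[OF o2 that(2)] row[OF o3 that(2)] by auto
  have F: "F t \<in> S"
    unfolding F_def using D S(2) outer[of 1 1]
    by (simp add: mult scale diff del: One_nat_def)
  show ?thesis
  proof (cases "t = 0")
    case True
    with t have "i \<in> {0, 1, 2, 3}" "j \<in> {0, 1, 2, 3}" by (auto simp: I_0)
    with True show ?thesis by (auto simp: e_def intro!: scale outer)
  qed (use S(2) sub(2) F in \<open>auto simp: e_def intro!: mult scale\<close>)
qed

end

section \<open>The seed vectors in coordinates\<close>

locale labelled_heawood_graph = based_heawood_graph adj x
  for adj :: "'v::finite \<Rightarrow> 'v \<Rightarrow> bool" and x +
  fixes u1 u2 u3 y1 y2 y3 y4 y5 y6 :: 'v
  assumes us_distinct: "distinct [u1, u2, u3]" and us_sphere: "set [u1, u2, u3] = dist_sphere adj 1 x"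
    and ys_distinct: "distinct [y1, y2, y3, y4, y5, y6]"
    and ys_sphere: "set [y1, y2, y3, y4, y5, y6] = dist_sphere adj 2 x"
    and pair12: "\<exists>u \<in> dist_sphere adj 1 x. adj u y1 \<and> adj u y2"
    and pair34: "\<exists>u \<in> dist_sphere adj 1 x. adj u y3 \<and> adj u y4"
    and pair56: "\<exists>u \<in> dist_sphere adj 1 x. adj u y5 \<and> adj u y6"
begin

lemma d_eq_1: "d u = 1 \<longleftrightarrow> u = u1 \<or> u = u2 \<or> u = u3"
  using us_sphere unfolding dist_sphere_def by auto

lemma d_eq_2: "d y = 2 \<longleftrightarrow> y = y1 \<or> y = y2 \<or> y = y3 \<or> y = y4 \<or> y = y5 \<or> y = y6"
  using ys_sphere unfolding dist_sphere_def by auto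

abbreviation b :: "'v \<Rightarrow> complex ^ 'v" where "b y \<equiv> axis y 1"

lemma b_nth: "b z $ y = (if y = z then 1 else 0)"
  by (simp add: axis_def)

lemma D_b: "D i *v b y = (if d y = i then b y else 0)"
  by (auto simp: Finite_Cartesian_Product.vec_eq_iff D_nth b_nth)

lemma dot_s_b: "dot (s i) (b y) = (if d y = i then 1 else 0)"
  by (simp add: dot_s b_nth)

lemma hermitian_inner_b: "hermitian_inner (b y) (b z) = (if y = z then 1 else 0)"
proof -
  have "hermitian_inner (b y) (b z) = (\<Sum>w\<in>UNIV. if w = y then if y = z then 1 else 0 else 0)"
    unfolding hermitian_inner_def by (rule sum.cong) (auto simp: b_nth)
  then show ?thesis by simp
qed

lemma A_b_nth: "(A *v b z) $ y = (if adj y z then 1 else 0)"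
  by (simp add: A_nth b_nth)

lemma unique_parent:
  assumes "d y = 2" "d u = 1" "d u' = 1" "adj u y" "adj u' y"
  shows "u = u'"
proof -
  have "card {z. adj y z \<and> d z = 1} = 1"
    unfolding card_nbrs_sphere using assms by (simp add: nbr_count_def)
  then obtain p where "{z. adj y z \<and> d z = 1} = {p}"
    by (rule card_1_singletonE)
  moreover have "u \<in> {z. adj y z \<and> d z = 1}" "u' \<in> {z. adj y z \<and> d z = 1}"
    using assms adj_sym by auto
  ultimately show ?thesis by (metis singletonD)
qed

text \<open>Both vertices have the same unique neighbour in sphere 1, so the lowering part of
  \<open>A\<close> cancels on the difference.\<close>

lemma F2_pair:
  assumes "\<exists>u \<in> dist_sphere adj 1 x. adj u y \<and> adj u y'" "d y = 2" "d y' = 2"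
  shows "F 2 *v (b y - b y') = b y - b y'"
proof -
  obtain u where u: "d u = 1" "adj u y" "adj u y'"
    using assms by (auto simp: dist_sphere_def)
  have "adj w y \<longleftrightarrow> adj w y'" if "d w = 1" for w
    using unique_parent[of y u w] unique_parent[of y' u w] u that assms by auto
  then have "D 1 *v (A *v (b y - b y')) = 0"
    by (simp add: Finite_Cartesian_Product.vec_eq_iff D_nth vec_lin A_b_nth)
  then show ?thesis
    using assms by (simp add: F2 vec_lin D_b)
qed

text \<open>The common neighbour \<open>u\<close> has no further neighbours in sphere 2, so this sum
  is the coordinate at \<open>u\<close> of the lowered vector, which vanishes by
  \<open>D1_A_F2\<close>.\<close>

lemma F2_fixed_pair:
  assumes "\<exists>u \<in> dist_sphere adj 1 x. adj u y \<and> adj u y'" "d y = 2" "d y' = 2" "y \<noteq> y'"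
    and w: "F 2 *v w = w"
  shows "w $ y + w $ y' = 0"
proof -
  obtain u where u: "d u = 1" "adj u y" "adj u y'"
    using assms by (auto simp: dist_sphere_def)
  have "card {z. adj u z \<and> d z = 2} = 2"
    unfolding card_nbrs_sphere using u by (simp add: nbr_count_def)
  then have nbrs: "{y, y'} = {z. adj u z \<and> d z = 2}"
    using u assms by (intro card_subset_eq) auto
  have supp: "w $ z = 0" if "d z \<noteq> 2" for z
    using D_F[of 2 2 w] w D_nth[of 2 w z] that by simp
  have "0 = (D 1 *v (A *v w)) $ u"
    using D1_A_F2[of w] w by simp
  also have "\<dots> = (\<Sum>z | adj u z. w $ z)"
    using u by (simp add: D_nth A_nth)
  also have "\<dots> = (\<Sum>z | adj u z \<and> d z = 2. w $ z)"
    using supp by (intro sum.mono_neutral_right) auto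
  also have "\<dots> = w $ y + w $ y'"
    unfolding nbrs[symmetric] using assms by simp
  finally show ?thesis by simp
qed

definition \<nu>1a where "\<nu>1a = b u1 - b u2"
definition \<nu>1b where "\<nu>1b = b u1 + b u2 - 2 *s b u3"
definition \<nu>2a where "\<nu>2a = b y1 - b y2"
definition \<nu>2b where "\<nu>2b = b y3 - b y4"
definition \<nu>2c where "\<nu>2c = b y5 - b y6"

lemmas \<nu>_defs = \<nu>1a_def \<nu>1b_def \<nu>2a_def \<nu>2b_def \<nu>2c_def

lemma d_us: "d u1 = 1" "d u2 = 1" "d u3 = 1"
  and d_ys: "d y1 = 2" "d y2 = 2" "d y3 = 2" "d y4 = 2" "d y5 = 2" "d y6 = 2"
  unfolding d_eq_1 d_eq_2 by auto

lemma F_seeds: "F 1 *v \<nu>1a = \<nu>1a" "F 1 *v \<nu>1b = \<nu>1b"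
  "F 2 *v \<nu>2a = \<nu>2a" "F 2 *v \<nu>2b = \<nu>2b" "F 2 *v \<nu>2c = \<nu>2c"
proof -
  show "F 1 *v \<nu>1a = \<nu>1a" "F 1 *v \<nu>1b = \<nu>1b"
    unfolding F1 by (simp_all add: \<nu>_defs vec_lin dot_lin D_b dot_s_b d_us del: One_nat_def)
  show "F 2 *v \<nu>2a = \<nu>2a" "F 2 *v \<nu>2b = \<nu>2b" "F 2 *v \<nu>2c = \<nu>2c"
    using pair12 pair34 pair56 d_ys by (simp_all only: \<nu>_defs F2_pair)
qed

lemma seeds_nonzero: "\<nu>1a \<noteq> 0" "\<nu>1b \<noteq> 0" "\<nu>2a \<noteq> 0" "\<nu>2b \<noteq> 0" "\<nu>2c \<noteq> 0" "s 0 \<noteq> 0"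
proof -
  have "\<nu>1a $ u1 = 1" "\<nu>1b $ u1 = 1" "\<nu>2a $ y1 = 1" "\<nu>2b $ y3 = 1" "\<nu>2c $ y5 = 1" "s 0 $ x = 1"
    using us_distinct ys_distinct by (auto simp: \<nu>_defs b_nth s_nth)
  then show "\<nu>1a \<noteq> 0" "\<nu>1b \<noteq> 0" "\<nu>2a \<noteq> 0" "\<nu>2b \<noteq> 0" "\<nu>2c \<noteq> 0" "s 0 \<noteq> 0" by auto
qed

lemma seeds_orthogonal: "hermitian_inner \<nu>1a \<nu>1b = 0" "hermitian_inner \<nu>2a \<nu>2b = 0"
  "hermitian_inner \<nu>2a \<nu>2c = 0" "hermitian_inner \<nu>2b \<nu>2c = 0"
  using us_distinct ys_distinct by (auto simp: \<nu>_defs hermitian_lin hermitian_inner_b)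

text \<open>Such a \<open>w\<close> lives on three vertices and has coordinate sum zero. The
  coefficients solve the equations at \<open>u1\<close> and \<open>u2\<close>; the one at
  \<open>u3\<close> follows.\<close>

lemma F1_fixed_expand:
  assumes w: "F 1 *v w = w"
  shows "w = ((w $ u1 - w $ u2) / 2) *s \<nu>1a + ((w $ u1 + w $ u2) / 2) *s \<nu>1b"
proof -
  have supp: "w $ z = 0" if "d z \<noteq> 1" for z
    using D_F[of 1 1 w] w D_nth[of 1 w z] that by simp
  have "0 = dot (s 1) w" using dot_s_F[of 1 1 w] w by simp
  also have "\<dots> = w $ u1 + w $ u2 + w $ u3"
  proof -
    have "{z. d z = 1} = {u1, u2, u3}" using d_eq_1 by auto
    then show ?thesis using us_distinct by (simp add: dot_s add.assoc)
  qed
  finally have u3: "w $ u3 = - (w $ u1 + w $ u2)"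
    by (metis add.commute eq_neg_iff_add_eq_0)
  show ?thesis
    unfolding Finite_Cartesian_Product.vec_eq_iff
  proof
    fix y
    consider "y = u1" | "y = u2" | "y = u3" | "d y \<noteq> 1"
      using d_eq_1 by blast
    note y_cases = this
    have ne: "u1 \<noteq> u2" "u2 \<noteq> u1" "u1 \<noteq> u3" "u3 \<noteq> u1" "u2 \<noteq> u3" "u3 \<noteq> u2"
      using us_distinct by auto
    show "w $ y = (((w $ u1 - w $ u2) / 2) *s \<nu>1a + ((w $ u1 + w $ u2) / 2) *s \<nu>1b) $ y"
    proof (cases rule: y_cases)
      case 3
      then show ?thesis using ne by (simp add: u3 \<nu>_defs b_nth) (simp add: field_simps)
    next
      case 4
      then have "y \<noteq> u1" "y \<noteq> u2" "y \<noteq> u3" using d_us by auto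
      then show ?thesis using supp[OF 4] by (simp add: \<nu>_defs b_nth)
    qed (use ne in \<open>simp_all add: \<nu>_defs b_nth field_simps\<close>)
  qed
qed

text \<open>Coordinates within a pair are opposite, so one coordinate from each pair is the
  coefficient of its seed.\<close>

lemma F2_fixed_expand:
  assumes w: "F 2 *v w = w"
  shows "w = (w $ y1) *s \<nu>2a + (w $ y3) *s \<nu>2b + (w $ y5) *s \<nu>2c"
proof -
  have supp: "w $ z = 0" if "d z \<noteq> 2" for z
    using D_F[of 2 2 w] w D_nth[of 2 w z] that by simp
  have "w $ y1 + w $ y2 = 0" "w $ y3 + w $ y4 = 0" "w $ y5 + w $ y6 = 0"
    using F2_fixed_pair pair12 pair34 pair56 d_ys ys_distinct w by auto
  then have "w $ y2 = - w $ y1" "w $ y4 = - w $ y3" "w $ y6 = - w $ y5"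
    by (simp_all add: eq_neg_iff_add_eq_0 add.commute)
  note pairs = this
  have ne: "y1 \<noteq> y2" "y1 \<noteq> y3" "y1 \<noteq> y4" "y1 \<noteq> y5" "y1 \<noteq> y6" "y2 \<noteq> y3" "y2 \<noteq> y4" "y2 \<noteq> y5" "y2 \<noteq> y6"
    "y3 \<noteq> y4" "y3 \<noteq> y5" "y3 \<noteq> y6" "y4 \<noteq> y5" "y4 \<noteq> y6" "y5 \<noteq> y6"
    using ys_distinct by auto
  show ?thesis
    unfolding Finite_Cartesian_Product.vec_eq_iff
  proof
    fix y
    consider "y = y1" | "y = y2" | "y = y3" | "y = y4" | "y = y5" | "y = y6" | "d y \<noteq> 2"
      using d_eq_2 by blast
    then show "w $ y = ((w $ y1) *s \<nu>2a + (w $ y3) *s \<nu>2b + (w $ y5) *s \<nu>2c) $ y"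
    proof cases
      case 7
      then have "y \<noteq> y1" "y \<noteq> y2" "y \<noteq> y3" "y \<noteq> y4" "y \<noteq> y5" "y \<noteq> y6" using d_ys by auto
      then show ?thesis using supp[OF 7] by (simp add: \<nu>_defs b_nth)
    qed (use ne ne[symmetric] pairs in \<open>simp_all add: \<nu>_defs b_nth\<close>)
  qed
qed

text \<open>The root row is the endpoint. Only the nonvanishing of its diagonal unit uses the
  labelled vertices: each such unit fixes an explicit nonzero seed.\<close>

sublocale matrix_units e types I "\<lambda>t. t"
proof
  fix t :: nat assume "t \<in> types"
  then have t: "t \<in> {0, 1, 2}" by (simp only: types_def)
  have "e 0 0 0 *v s 0 = s 0" "e 1 1 1 *v \<nu>1a = \<nu>1a" "e 2 2 2 *v \<nu>2a = \<nu>2a"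
    by (simp_all add: e_0 dot_s_s e_pos F_seeds del: One_nat_def)
  then have "e 0 0 0 \<noteq> 0" "e 1 1 1 \<noteq> 0" "e 2 2 2 \<noteq> 0"
    using seeds_nonzero by auto
  with t show "e t t t \<noteq> 0" by auto
qed (use e_mult e_sum in \<open>auto simp: I_def types_def simp del: One_nat_def\<close>)

lemma seeds: "seed 0 (s 0)" "seed 1 \<nu>1a" "seed 1 \<nu>1b" "seed 2 \<nu>2a" "seed 2 \<nu>2b" "seed 2 \<nu>2c"
  using seeds_nonzero unfolding seed_def
  by (simp_all add: types_mem e_0 dot_s_s e_pos F_seeds del: One_nat_def)

end

section \<open>The decomposition of the standard module\<close>

context labelled_heawood_graph
begin

text \<open>\<open>A\<close> is multiplied with the resolution of the identity into diagonal units,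
  and \<open>A_e\<close> is applied to each term.\<close>

lemma A_in_alg: "A \<in> alg"
proof -
  have "A ** e t i i \<in> alg" if t: "t \<in> types" "i \<in> I t" for t i
  proof -
    obtain a b k l where kl: "k \<in> I t" "l \<in> I t"
      "\<And>v. A *v (e t i i *v v) = a *s (e t k i *v v) + b *s (e t l i *v v)"
      using A_e[OF t(1,2,2)] by blast
    then have "A ** e t i i = cscale_matrix a (e t k i) + cscale_matrix b (e t l i)"
      by (simp add: Finite_Cartesian_Product.matrix_eq cscale_matrix_vector_mult
          matrix_vector_mult_add_rdistrib flip: matrix_vector_mul_assoc)
    then show ?thesis using kl t by (auto intro!: alg_add alg_scale unit_in_alg)
  qed
  then have "(\<Sum>t\<in>types. \<Sum>i\<in>I t. A ** e t i i) \<in> alg"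
    by (intro cmat.subspace_sum[OF alg_subspace])
  moreover have "(\<Sum>t\<in>types. \<Sum>i\<in>I t. A ** e t i i) = A ** (\<Sum>t\<in>types. \<Sum>i\<in>I t. e t i i)"
    by (simp only: matrix_mult_sum_right)
  ultimately show ?thesis unfolding unit_sum by simp
qed

lemma D_in_alg: "D k \<in> alg"
proof -
  have "D k ** e t i i \<in> alg" if t: "t \<in> types" "i \<in> I t" for t i
  proof -
    have "D k ** e t i i = (if k = i then e t i i else 0)"
      using D_e[OF t(1,2,2)]
      by (auto simp: Finite_Cartesian_Product.matrix_eq simp flip: matrix_vector_mul_assoc)
    then show ?thesis using t by (auto intro!: alg_zero unit_in_alg)
  qed
  then have "(\<Sum>t\<in>types. \<Sum>i\<in>I t. D k ** e t i i) \<in> alg"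
    by (intro cmat.subspace_sum[OF alg_subspace])
  moreover have "(\<Sum>t\<in>types. \<Sum>i\<in>I t. D k ** e t i i) = D k ** (\<Sum>t\<in>types. \<Sum>i\<in>I t. e t i i)"
    by (simp only: matrix_mult_sum_right)
  ultimately show ?thesis unfolding unit_sum by simp
qed

lemma terwilliger_algebra_eq: "terwilliger_algebra adj x = alg"
proof
  let ?G = "{A} \<union> {D i | i. i \<le> graph_diameter adj}"
  show "terwilliger_algebra adj x \<subseteq> alg"
    unfolding terwilliger_algebra_def
    by (rule hull_minimal) (use A_in_alg D_in_alg matrix_subalgebra_alg in auto)
  have "alg \<subseteq> S" if S: "matrix_subalgebra S" "?G \<subseteq> S" for S
  proof -
    have "D i \<in> S" if "i \<le> 3" for i
      using S(2) that diameter by auto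
    then have "units \<subseteq> S"
      using S e_in_subalgebra[OF S(1)] by (auto simp: units_def simp del: insert_iff)
    then show ?thesis
      unfolding alg_def using S by (intro cmat.span_minimal) (auto simp: matrix_subalgebra_def)
  qed
  then show "alg \<subseteq> terwilliger_algebra adj x"
    unfolding terwilliger_algebra_def hull_def by blast
qed

lemma I_mem: "t \<in> types \<Longrightarrow> t \<in> I t"
  by (auto simp: I_def types_def)

text \<open>Moving a unit across the inner product leaves \<open>v\<close> against a product of two
  units applied to \<open>w\<close>. This is zero, or it is \<open>w\<close> itself when types and
  rows agree; so only the generators have to be compared.\<close>

lemma cyclic_orthogonal:
  assumes v: "seed t v" and w: "seed r w" and orth: "t \<noteq> r \<or> hermitian_inner v w = 0"
    and "p \<in> cyclic v" "q \<in> cyclic w"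
  shows "hermitian_inner p q = 0"
proof -
  have t: "t \<in> types" "t \<in> I t" and r: "r \<in> types" "r \<in> I r" and w': "e r r r *v w = w"
    using v w I_mem by (auto simp: seed_def)
  have "hermitian_inner (e t i t *v v) (e r j r *v w) = 0" if ij: "i \<in> I t" "j \<in> I r" for i j
  proof -
    obtain c where "hermitian_inner (e t i t *v v) (e r j r *v w)
        = c * hermitian_inner v (e t t i *v (e r j r *v w))"
      using e_adjoint[OF t(1) ij(1) t(2)] by blast
    then show ?thesis
      using unit_vec_mult[OF t ij(1) r(1) ij(2) r(2), of w] orth w' by auto
  qed
  then show ?thesis
    using assms(4,5) hermitian_inner_span[of "(\<lambda>i. e t i t *v v) ` I t" "(\<lambda>i. e r i r *v w) ` I r"]
    unfolding cyclic_eq_span[OF v] cyclic_eq_span[OF w] by blast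
qed

abbreviation W0 where "W0 \<equiv> cyclic (s 0)"
abbreviation W1a where "W1a \<equiv> cyclic \<nu>1a"
abbreviation W1b where "W1b \<equiv> cyclic \<nu>1b"
abbreviation W2a where "W2a \<equiv> cyclic \<nu>2a"
abbreviation W2b where "W2b \<equiv> cyclic \<nu>2b"
abbreviation W2c where "W2c \<equiv> cyclic \<nu>2c"

lemma isotypic_mem:
  assumes "t \<in> types"
  shows "(\<Sum>i\<in>I t. e t i t *v (c i *s v)) \<in> cyclic v"
proof (rule alg_module_sum_mem[OF cyclic_module])
  fix i assume "i \<in> I t"
  then have "e t i t \<in> alg" using assms I_mem by (simp add: unit_in_alg)
  then show "e t i t *v (c i *s v) \<in> cyclic v"
    using cyclic_module[of v] self_in_cyclic[of v] vec.subspace_scale unfolding alg_module_def by blast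
qed

lemma isotypic_expand:
  assumes "t \<in> types"
  shows "(\<Sum>i\<in>I t. e t i i *v v) = (\<Sum>i\<in>I t. e t i t *v (e t t i *v v))"
  using assms I_mem[OF assms] by (intro sum.cong) (simp_all add: unit_vec_mult)

text \<open>Each component \<open>e t i i *v v\<close> is moved to the root row, expanded there in
  the seeds of its type, and moved back by \<open>e t i t\<close>.\<close>

lemma decomposition_exists:
  "\<exists>w0\<in>W0. \<exists>w1a\<in>W1a. \<exists>w1b\<in>W1b. \<exists>w2a\<in>W2a. \<exists>w2b\<in>W2b. \<exists>w2c\<in>W2c. v = w0 + w1a + w1b + w2a + w2b + w2c"
proof -
  let ?w = "\<lambda>t i. e t t i *v v"
  have fixed1: "F 1 *v ?w 1 i = ?w 1 i" if "i \<in> I 1" for i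
    using unit_vec_mult[of 1 1 1 1 1 i v] that I_mem[of 1] by (simp add: types_mem e_pos del: One_nat_def)
  have fixed2: "F 2 *v ?w 2 i = ?w 2 i" if "i \<in> I 2" for i
    using unit_vec_mult[of 2 2 2 2 2 i v] that I_mem[of 2] by (simp add: types_mem e_pos)
  \<comment> \<open>\<open>c\<close> reads off the coefficient of the seed \<open>n\<close> from a
    vector in the root row; for type 0 it is the coordinate at \<open>x\<close>, since
    \<open>s 0\<close> is the indicator of \<open>x\<close>.\<close>
  define g where "g t c n = (\<Sum>i\<in>I t. e t i t *v (c (?w t i) *s n))"
    for t and c :: "complex ^ 'v \<Rightarrow> complex" and n :: "complex ^ 'v"
  have mem: "g t c n \<in> cyclic n" if "t \<in> types" for t c n
    unfolding g_def by (rule isotypic_mem[OF that])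
  have v0: "(\<Sum>i\<in>I 0. e 0 i i *v v) = g 0 (\<lambda>w. w $ x) (s 0)"
    unfolding isotypic_expand[OF types_mem(1)] g_def
  proof (rule sum.cong)
    fix i assume "i \<in> I 0"
    have "s 0 $ x = 1" by (simp add: s_nth)
    then show "e 0 i 0 *v ?w 0 i = e 0 i 0 *v (?w 0 i $ x *s s 0)"
      by (simp add: e_0)
  qed simp
  have v1: "(\<Sum>i\<in>I 1. e 1 i i *v v)
      = g 1 (\<lambda>w. (w $ u1 - w $ u2) / 2) \<nu>1a + g 1 (\<lambda>w. (w $ u1 + w $ u2) / 2) \<nu>1b"
  proof -
    have "(\<Sum>i\<in>I 1. e 1 i i *v v) = (\<Sum>i\<in>I 1. e 1 i 1 *v ?w 1 i)"
      by (rule isotypic_expand) (rule types_mem)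
    also have "\<dots> = (\<Sum>i\<in>I 1. e 1 i 1 *v (((?w 1 i $ u1 - ?w 1 i $ u2) / 2) *s \<nu>1a
        + ((?w 1 i $ u1 + ?w 1 i $ u2) / 2) *s \<nu>1b))"
      by (rule sum.cong) (simp_all only: F1_fixed_expand[OF fixed1, symmetric])
    finally show ?thesis
      by (simp only: g_def matrix_vector_right_distrib sum.distrib)
  qed
  have v2: "(\<Sum>i\<in>I 2. e 2 i i *v v) = g 2 (\<lambda>w. w $ y1) \<nu>2a + g 2 (\<lambda>w. w $ y3) \<nu>2b + g 2 (\<lambda>w. w $ y5) \<nu>2c"
  proof -
    have "(\<Sum>i\<in>I 2. e 2 i i *v v) = (\<Sum>i\<in>I 2. e 2 i 2 *v ?w 2 i)"
      by (rule isotypic_expand) (rule types_mem)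
    also have "\<dots> = (\<Sum>i\<in>I 2. e 2 i 2 *v ((?w 2 i $ y1) *s \<nu>2a + (?w 2 i $ y3) *s \<nu>2b
        + (?w 2 i $ y5) *s \<nu>2c))"
      by (rule sum.cong) (simp_all only: F2_fixed_expand[OF fixed2, symmetric])
    finally show ?thesis
      by (simp only: g_def matrix_vector_right_distrib sum.distrib)
  qed
  have "v = (\<Sum>i\<in>I 0. e 0 i i *v v) + (\<Sum>i\<in>I 1. e 1 i i *v v) + (\<Sum>i\<in>I 2. e 2 i i *v v)"
    using vec_expand[of v] by (simp add: types_def add.assoc)
  then show ?thesis
    unfolding v0 v1 v2 add.assoc[symmetric] using mem types_mem by blast
qed

lemma decomposition: "orthogonal_irreducible_decomposition alg [W0, W1a, W1b, W2a, W2b, W2c]"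
  unfolding orthogonal_irreducible_decomposition_def
proof (intro conjI orthogonal_direct_sumI)
  let ?Ws = "[W0, W1a, W1b, W2a, W2b, W2c]"
  show "\<forall>W\<in>set ?Ws. irreducible_module alg W"
    using seeds irreducible_cyclic by auto
  show "vec.subspace (?Ws ! i)" if "i < length ?Ws" for i
  proof -
    have "?Ws ! i \<in> set ?Ws" using that by (rule nth_mem)
    then show ?thesis using cyclic_module by (auto simp: alg_module_def)
  qed
  define vs where "vs = [s 0, \<nu>1a, \<nu>1b, \<nu>2a, \<nu>2b, \<nu>2c]"
  define ts where "ts = [0, 1, 1, 2, 2, 2 :: nat]"
  have six: "i = 0 \<or> i = 1 \<or> i = 2 \<or> i = 3 \<or> i = 4 \<or> i = 5" if "i < 6" for i :: nat
    using that by linarith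
  have Ws: "?Ws ! i = cyclic (vs ! i)" if "i < 6" for i
    using six[OF that] by (auto simp: vs_def)
  have seed: "seed (ts ! i) (vs ! i)" if "i < 6" for i
    using six[OF that] seeds by (auto simp: vs_def ts_def)
  have sym: "hermitian_inner v u = 0" if "hermitian_inner u v = 0" for u v :: "complex ^ 'v"
    using that hermitian_inner_commute[of v u] by simp
  have orth: "ts ! i \<noteq> ts ! j \<or> hermitian_inner (vs ! i) (vs ! j) = 0" if "i < 6" "j < 6" "i \<noteq> j" for i j
    using six[OF that(1)] six[OF that(2)] that(3) seeds_orthogonal seeds_orthogonal[THEN sym]
    by (elim disjE) (simp_all add: vs_def ts_def)
  show "hermitian_inner u v = 0"
    if "i < length ?Ws" "j < length ?Ws" "i \<noteq> j" "u \<in> ?Ws ! i" "v \<in> ?Ws ! j" for i j u v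
  proof -
    have ij: "i < 6" "j < 6" using that by simp_all
    show ?thesis
      using cyclic_orthogonal[OF seed[OF ij(1)] seed[OF ij(2)] orth[OF ij that(3)]]
        that(4,5) Ws ij by metis
  qed
  show "\<exists>ws. length ws = length ?Ws \<and> (\<forall>i < length ?Ws. ws ! i \<in> ?Ws ! i) \<and> sum_list ws = v" for v
  proof -
    obtain w0 w1a w1b w2a w2b w2c where w: "w0 \<in> W0" "w1a \<in> W1a" "w1b \<in> W1b"
      "w2a \<in> W2a" "w2b \<in> W2b" "w2c \<in> W2c" and v: "v = w0 + w1a + w1b + w2a + w2b + w2c"
      using decomposition_exists by metis
    let ?ws = "[w0, w1a, w1b, w2a, w2b, w2c]"
    have "?ws ! i \<in> ?Ws ! i" if "i < 6" for i
      using six[OF that] w by auto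
    then show ?thesis
      using v by (intro exI[of _ ?ws]) (simp add: add.assoc)
  qed
qed

text \<open>\<open>D i\<close> selects row \<open>i\<close> in all blocks (\<open>D_e\<close>), and
  by \<open>unit_cyclic\<close> only block \<open>t\<close> contributes, with one line per
  row.\<close>

lemma component_cyclic:
  assumes v: "seed t v"
  shows "component adj x i (cyclic v) = (if i \<in> I t then vec.span {e t i t *v v} else {0})"
proof -
  have t: "t \<in> types" "t \<in> I t"
    using v I_mem by (auto simp: seed_def)
  have D_mem: "D i *v w \<in> (if i \<in> I t then vec.span {e t i t *v v} else {0})" if w: "w \<in> cyclic v" for w
  proof -
    let ?S = "if i \<in> I t then vec.span {e t i t *v v} else {0}"
    have sub: "vec.subspace ?S" by simp
    have "D i *v (e r k k *v w) \<in> ?S" if r: "r \<in> types" "k \<in> I r" for r k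
    proof -
      obtain c where "e r k k *v w = (if r = t then c *s (e t k t *v v) else 0)"
        using unit_cyclic[OF v r(1,2,2) w] by blast
      then show ?thesis
        using D_e[OF r(1,2,2), of i w] r by (auto simp: vec.span_singleton)
    qed
    then have "(\<Sum>r\<in>types. \<Sum>k\<in>I r. D i *v (e r k k *v w)) \<in> ?S"
      by (intro vec.subspace_sum[OF sub])
    then show ?thesis
      by (subst vec_expand[of w]) (simp only: matrix_vector_mult_sum_right)
  qed
  have "vec.span {e t i t *v v} \<subseteq> component adj x i (cyclic v)" if i: "i \<in> I t"
  proof -
    have "c *s (e t i t *v v) = D i *v (e t i t *v (c *s v))" for c
      using D_e[OF t(1) i t(2), of i v] by (simp only: matrix_vector_mult_scale simp_thms if_True)
    moreover have "e t i t *v (c *s v) \<in> cyclic v" for c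
      using cyclic_module[of v] self_in_cyclic[of v] unit_in_alg[OF t(1) i t(2)] vec.subspace_scale
      unfolding alg_module_def by blast
    ultimately show ?thesis
      unfolding vec.span_singleton component_def by blast
  qed
  moreover have "0 \<in> component adj x i (cyclic v)"
    using cyclic_module[of v] vec.subspace_0 unfolding component_def alg_module_def
    by (intro image_eqI[of _ _ 0]) auto
  ultimately show ?thesis
    using D_mem unfolding component_def by (auto split: if_splits)
qed

lemma seed_unit_nonzero:
  assumes "seed t v" "i \<in> I t"
  shows "e t i t *v v \<noteq> 0"
proof
  assume "e t i t *v v = 0"
  then have "e t t i *v (e t i t *v v) = 0" by simp
  with assms I_mem show False by (simp add: unit_vec_mult seed_def)
qed

lemma dim_span_singleton: "w \<noteq> 0 \<Longrightarrow> vec.dim (vec.span {w :: complex ^ 'v}) = 1"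
  using vec.dim_span_eq_card_independent[of "{w}"] by (simp only: vec.independent_insert) auto

definition last_index :: "nat \<Rightarrow> nat" where "last_index t = (if t = 1 then 2 else 3)"

text \<open>The basis vectors \<open>e t i t *v v\<close> lie one in each sphere of
  \<open>I t\<close>, so support, diameter, shape and purity are all read off this interval.\<close>

lemma module_data_cyclic:
  assumes v: "seed t v" and dec: "orthogonal_irreducible_decomposition alg Ws"
    and m: "length (filter (of_type t) Ws) = m"
    and vs: "vs = map (\<lambda>i. e t i t *v v) [t..<Suc (last_index t)]"
    and \<delta>: "\<delta> = last_index t - t" and rep: "represents B A vs"
  shows "module_data adj x (cyclic v) t m (Suc \<delta>) \<delta> (replicate (Suc \<delta>) 1) vs B"
    "endpoint adj x (cyclic v) = t"
proof -
  have t: "t \<in> types" "t \<in> I t"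
    using v I_mem by (auto simp: seed_def)
  have I: "I t = {t..last_index t}" "t \<le> last_index t" "last_index t \<le> 3"
    using t by (auto simp: I_def last_index_def types_def)
  have comp: "component adj x i (cyclic v) = vec.span {e t i t *v v}" if "i \<in> I t" for i
    using component_cyclic[OF v] that by simp
  have supp: "module_support adj x (cyclic v) = {t..last_index t}"
  proof -
    have "vec.span {e t i t *v v} \<noteq> {0}" if "i \<in> I t" for i
      using seed_unit_nonzero[OF v that] vec.span_base[of "e t i t *v v" "{e t i t *v v}"] by auto
    then show ?thesis
      using I unfolding module_support_def component_cyclic[OF v] diameter by (auto split: if_splits)
  qed
  show endp: "endpoint adj x (cyclic v) = t"
    unfolding endpoint_def supp using I(2) by (intro Min_eqI) auto
  have diam: "module_diameter adj x (cyclic v) = \<delta>"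
    unfolding module_diameter_def supp using I(2) \<delta> by simp
  have interval: "[t..<t + \<delta> + 1] = [t..<Suc (last_index t)]"
    using I(2) \<delta> by simp
  have shape: "module_shape adj x (cyclic v) = replicate (Suc \<delta>) 1"
  proof -
    have "module_shape adj x (cyclic v) = map (\<lambda>i. 1) [t..<t + \<delta> + 1]"
      unfolding module_shape_def endp diam interval
      using I comp seed_unit_nonzero[OF v] by (intro map_cong) (auto simp: dim_span_singleton)
    then show ?thesis by (simp add: map_replicate_const)
  qed
  have set: "set vs = (\<lambda>i. e t i t *v v) ` I t"
    unfolding vs I(1) by auto
  have basis: "ordered_basis (cyclic v) vs"
  proof -
    have "distinct vs"
      unfolding vs distinct_map using seed_basis(1)[OF v] I(1) by (simp add: atLeastLessThanSuc_atLeastAtMost del: upt_Suc)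
    then show ?thesis
      unfolding ordered_basis_def set using seed_basis(2)[OF v] cyclic_eq_span[OF v] by simp
  qed
  have "vec.dim (cyclic v) = card (set vs)"
    unfolding cyclic_eq_span[OF v] set by (rule vec.dim_span_eq_card_independent[OF seed_basis(2)[OF v]])
  also have "\<dots> = length vs"
    using basis by (simp add: ordered_basis_def distinct_card)
  finally have dim: "vec.dim (cyclic v) = Suc \<delta>"
    using I(2) by (simp add: vs \<delta> Suc_diff_le)
  have "pure_vector adj x ([t..<Suc (last_index t)] ! j) (vs ! j)" if "j < length vs" for j
  proof -
    have i: "[t..<Suc (last_index t)] ! j \<in> I t" "vs ! j = e t (t + j) t *v v" "[t..<Suc (last_index t)] ! j = t + j"
      using that I by (auto simp: vs simp del: upt_Suc)
    then have "e t (t + j) t *v v = D (t + j) *v (e t (t + j) t *v v)"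
      using D_e[OF t(1) _ t(2), of "t + j" "t + j" v] by simp
    then show ?thesis
      using i I seed_unit_nonzero[OF v] unfolding pure_vector_def component_def diameter
      by auto
  qed
  then have pure: "pure_basis adj x (cyclic v) vs"
    unfolding pure_basis_def using basis
    by (intro conjI exI[of _ "[t..<Suc (last_index t)]"]) (auto simp: vs simp del: upt_Suc)
  show "module_data adj x (cyclic v) t m (Suc \<delta>) \<delta> (replicate (Suc \<delta>) 1) vs B"
    unfolding module_data_def terwilliger_algebra_eq
    using endp has_multiplicity_cyclic[OF dec v] m dim diam shape pure rep by simp
qed

lemma seed_vector_cyclic:
  assumes v: "seed t v" and endp: "endpoint adj x (cyclic v) = t"
    and ys: "set ys = dist_sphere adj t x" and es: "essential_part ys v = es"
  shows "seed_vector adj x (cyclic v) ys es v"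
proof -
  have t: "t \<in> types" "t \<in> I t" and v': "v \<noteq> 0" "e t t t *v v = v"
    using v I_mem by (auto simp: seed_def)
  have "v = D t *v v" using D_e[OF t(1,2,2), of t v] v' by simp
  moreover have "t \<le> 3" using t by (auto simp: types_def)
  ultimately have "pure_vector adj x t v"
    unfolding pure_vector_def component_def diameter using v' by auto
  then show ?thesis
    unfolding seed_vector_def endp component_cyclic[OF v]
    using ys es t v' dim_span_singleton by simp
qed

end

section \<open>Spectra\<close>

context based_heawood_graph
begin

lemma eigenspace_subspace: "vec.subspace (eigenspace A \<theta>)"
  by (auto simp: eigenspace_def vec.subspace_def vec_lin vector_add_ldistrib vector_smult_assoc mult.commute)

text \<open>A vector splits into the halves of \<open>v + A v / \<theta>\<close> and
  \<open>v - A v / \<theta>\<close>, so multiplicities can be counted through the simpler matrix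
  \<open>A^2\<close>.\<close>

lemma eigenspace_sum:
  assumes "\<theta> \<noteq> 0"
  shows "{v + w | v w. v \<in> eigenspace A \<theta> \<and> w \<in> eigenspace A (- \<theta>)} = {v. A *v (A *v v) = \<theta>\<^sup>2 *s v}"
    (is "?S = ?Q")
proof
  show "?S \<subseteq> ?Q"
    by (auto simp: eigenspace_def vec_lin vector_add_ldistrib vector_smult_assoc power2_eq_square
        vector_smult_lneg vector_smult_rneg)
  show "?Q \<subseteq> ?S"
  proof clarify
    fix v assume v: "A *v (A *v v) = \<theta>\<^sup>2 *s v"
    let ?p = "(1/2) *s (v + (1/\<theta>) *s (A *v v))" and ?q = "(1/2) *s (v - (1/\<theta>) *s (A *v v))"
    have "v = ?p + ?q"
      by (simp add: Finite_Cartesian_Product.vec_eq_iff field_simps)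
    moreover have "?p \<in> eigenspace A \<theta>" "?q \<in> eigenspace A (- \<theta>)"
      using assms by (simp_all add: eigenspace_def vec_lin v)
        (simp_all add: Finite_Cartesian_Product.vec_eq_iff field_simps power2_eq_square)
    ultimately show "\<exists>a b. v = a + b \<and> a \<in> eigenspace A \<theta> \<and> b \<in> eigenspace A (- \<theta>)" by blast
  qed
qed

lemma eigenspace_dim_sum:
  assumes "\<theta> \<noteq> 0"
  shows "vec.dim {v. A *v (A *v v) = \<theta>\<^sup>2 *s v} = vec.dim (eigenspace A \<theta>) + vec.dim (eigenspace A (- \<theta>))"
proof -
  have "v = 0" if "v \<in> eigenspace A \<theta>" "v \<in> eigenspace A (- \<theta>)" for v
  proof -
    have "\<theta> *s v = (- \<theta>) *s v" using that by (simp add: eigenspace_def)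
    then have "\<theta> * v $ y = - (\<theta> * v $ y)" for y
      by (metis mult_minus_left vector_smult_component)
    then show ?thesis using assms by (simp add: Finite_Cartesian_Product.vec_eq_iff)
  qed
  moreover have "0 \<in> eigenspace A \<theta>" for \<theta>
    by (simp add: eigenspace_def)
  ultimately have "eigenspace A \<theta> \<inter> eigenspace A (- \<theta>) = {0}" by blast
  moreover have "vec.dim {0 :: complex ^ 'v} = 0" by simp
  ultimately show ?thesis
    using vec.dim_sums_Int[OF eigenspace_subspace[of \<theta>] eigenspace_subspace[of "- \<theta>"]]
    unfolding eigenspace_sum[OF assms] by (simp only: add_0_right)
qed

lemma A_alternating:
  "A *v (D 0 *v v - D 1 *v v + D 2 *v v - D 3 *v v)
    = - (D 0 *v (A *v v) - D 1 *v (A *v v) + D 2 *v (A *v v) - D 3 *v (A *v v))"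
proof -
  have sign: "(D 0 *v w - D 1 *v w + D 2 *v w - D 3 *v w) $ y = (-1) ^ d y * w $ y" for w y
    using d_cases[of y] by (auto simp: D_nth simp del: One_nat_def)
  have "(-1) ^ d z * v $ z = - ((-1) ^ d y * v $ z)" if "adj y z" for y z
    using adj_gdist[OF that, of x] by auto
  then have "(A *v (D 0 *v v - D 1 *v v + D 2 *v v - D 3 *v v)) $ y
      = - ((-1) ^ d y * (A *v v) $ y)" for y
    unfolding A_nth sum_distrib_left sum_negf[symmetric] sign by (intro sum.cong) auto
  then show ?thesis
    unfolding Finite_Cartesian_Product.vec_eq_iff vector_uminus_component sign by blast
qed

text \<open>The graph is bipartite: the sign matrix \<open>P\<close>, with entries
  \<open>(-1) ^ d y\<close>, is an involution anticommuting with \<open>A\<close> and exchanges the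
  two eigenspaces.\<close>

lemma eigenspace_dim_neg: "vec.dim (eigenspace A (- \<theta>)) = vec.dim (eigenspace A \<theta>)"
proof -
  define P where "P = D 0 - D 1 + D 2 - D 3"
  have P: "P *v v = D 0 *v v - D 1 *v v + D 2 *v v - D 3 *v v" for v
    by (simp add: P_def matrix_vector_mult_diff_rdistrib matrix_vector_mult_add_rdistrib)
  have inv: "P *v (P *v v) = v" for v
    unfolding P by (simp add: vec_lin D_D D_sum[symmetric] del: One_nat_def)
  have mem: "P *v v \<in> eigenspace A (- \<theta>)" if "v \<in> eigenspace A \<theta>" for v \<theta>
  proof -
    have "A *v (P *v v) = - (P *v (A *v v))"
      unfolding P by (rule A_alternating)
    then show ?thesis
      using that by (simp add: eigenspace_def vec_lin)
  qed
  have "(*v) P ` eigenspace A \<theta> = eigenspace A (- \<theta>)"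
  proof
    show "eigenspace A (- \<theta>) \<subseteq> (*v) P ` eigenspace A \<theta>"
      using mem[of _ "- \<theta>"] inv by (metis image_eqI minus_minus subsetI)
  qed (use mem in auto)
  moreover have "vec.dim ((*v) P ` eigenspace A \<theta>) = vec.dim (eigenspace A \<theta>)"
    by (rule vec.dim_image_eq) (auto intro: inj_on_inverseI[of _ "(*v) P"] simp: inv)
  ultimately show ?thesis by simp
qed

text \<open>For an eigenvector both colour classes have the same sum \<open>p\<close>, as summing
  \<open>A v\<close> over one class counts the other three times. Then \<open>A_A\<close> reads
  \<open>9 v = 2 v + p j\<close>, with \<open>j\<close> the all-ones vector.\<close>

lemma eigenspace_3: "eigenspace A 3 = vec.span {s 0 + s 1 + s 2 + s 3}"
proof
  let ?j = "s 0 + s 1 + s 2 + s 3"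
  show "vec.span {?j} \<subseteq> eigenspace A 3"
  proof (rule vec.span_minimal)
    have "A *v ?j = 3 *s ?j"
      by (simp only: matrix_vector_right_distrib A_s)
        (simp add: Finite_Cartesian_Product.vec_eq_iff del: One_nat_def)
    then show "{?j} \<subseteq> eigenspace A 3" by (simp only: eigenspace_def) simp
  qed (rule eigenspace_subspace)
  show "eigenspace A 3 \<subseteq> vec.span {?j}"
  proof
    fix v assume "v \<in> eigenspace A 3"
    then have v: "A *v v = 3 *s v" by (simp add: eigenspace_def)
    define p where "p = dot (s 0) v + dot (s 2) v"
    have "3 * p = 3 * (dot (s 1) v + dot (s 3) v)"
      using dot_s_A(1,3)[of v] by (simp add: v dot_scale_right p_def algebra_simps)
    then have "dot (s 1) v + dot (s 3) v = p"
      by (metis mult_cancel_left zero_neq_numeral)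
    then have "A *v (A *v v) = 2 *s v + p *s ?j"
      unfolding A_A p_def[symmetric] by (simp add: vector_add_ldistrib algebra_simps)
    then have "9 *s v = 2 *s v + p *s ?j"
      by (simp add: v vec_lin vector_smult_assoc)
    then have "v = (p/7) *s ?j"
      by (simp add: Finite_Cartesian_Product.vec_eq_iff field_simps)
    then show "v \<in> vec.span {?j}"
      by (metis vec.span_base vec.span_scale insertI1)
  qed
qed

lemma dim_eigenspace_3: "vec.dim (eigenspace A 3) = 1"
proof -
  have "(s 0 + s 1 + s 2 + s 3) $ x = 1" by (simp add: s_nth)
  then have "s 0 + s 1 + s 2 + s 3 \<noteq> 0" by (metis zero_index zero_neq_one)
  then show ?thesis
    unfolding eigenspace_3 using vec.dim_span_eq_card_independent[of "{s 0 + s 1 + s 2 + s 3}"]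
    by (simp only: vec.independent_insert) auto
qed

text \<open>The range of \<open>A^2 - 2\<close> is spanned by the two colour class indicators, which
  \<open>A\<close> exchanges up to the factor 3.\<close>

lemma square_polynomial: "A *v (A *v (A *v (A *v v) - 2 *s v)) = 9 *s (A *v (A *v v) - 2 *s v)"
proof -
  define p q where "p = dot (s 0) v + dot (s 2) v" and "q = dot (s 1) v + dot (s 3) v"
  have "A *v (A *v v) - 2 *s v = p *s (s 0 + s 2) + q *s (s 1 + s 3)"
    by (simp add: A_A p_def q_def)
  then show ?thesis
    by (simp add: vec_lin A_s del: One_nat_def)
      (simp add: Finite_Cartesian_Product.vec_eq_iff algebra_simps)
qed

text \<open>The eigenvalue 9 of \<open>A^2\<close> takes 1 + 1 of the 14 dimensions; the remaining
  12 belong to 2 and are shared evenly by \<theta> and its negative.\<close>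

lemma dim_eigenspace_sqrt2:
  assumes "CARD('v) = 14" and \<theta>: "\<theta>\<^sup>2 = 2"
  shows "vec.dim (eigenspace A \<theta>) = 6"
proof -
  let ?Q = "\<lambda>c. {v. A *v (A *v v) = c *s v}"
  have sub: "vec.subspace (?Q c)" for c
    by (auto simp: vec.subspace_def vec_lin vector_add_ldistrib vector_smult_assoc mult.commute)
  have "v \<in> {p + q | p q. p \<in> ?Q 2 \<and> q \<in> ?Q 9}" for v
  proof -
    \<comment> \<open>The component for the eigenvalue 9: \<open>A^2 - 2\<close> kills the other
      component and multiplies this one by 7.\<close>
    define q where "q = (1/7) *s (A *v (A *v v) - 2 *s v)"
    have q: "A *v (A *v q) = 9 *s q"
      unfolding q_def matrix_vector_mult_scale square_polynomial by (simp add: vector_smult_assoc)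
    have "A *v (A *v (v - q)) = 2 *s (v - q)"
      unfolding matrix_vector_mult_diff_distrib q
      by (simp add: q_def Finite_Cartesian_Product.vec_eq_iff field_simps)
    moreover have "v = (v - q) + q" by simp
    ultimately show ?thesis using q by blast
  qed
  then have sum: "{p + q | p q. p \<in> ?Q 2 \<and> q \<in> ?Q 9} = UNIV" by blast
  have int: "?Q 2 \<inter> ?Q 9 = {0}"
  proof -
    have "v = 0" if "A *v (A *v v) = 2 *s v" "A *v (A *v v) = 9 *s v" for v
      using that by (auto simp: Finite_Cartesian_Product.vec_eq_iff)
    then show ?thesis by auto
  qed
  have "vec.dim {0 :: complex ^ 'v} = 0" by simp
  then have "14 = vec.dim (?Q 2) + vec.dim (?Q 9)"
    using vec.dim_sums_Int[OF sub[of 2] sub[of 9]] assms(1)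
    unfolding sum int by (simp only: vec_dim_card add_0_right)
  moreover have "vec.dim (?Q 9) = 2"
    using eigenspace_dim_sum[of 3] eigenspace_dim_neg[of 3] dim_eigenspace_3 by simp
  moreover have "\<theta> \<noteq> 0" using \<theta> by auto
  then have "vec.dim (?Q 2) = 2 * vec.dim (eigenspace A \<theta>)"
    using eigenspace_dim_sum[of \<theta>] eigenspace_dim_neg[of \<theta>] \<theta> by simp
  ultimately show ?thesis by simp
qed

lemma eigenvalue_cases:
  assumes v: "A *v v = \<theta> *s v" "v \<noteq> 0"
  shows "\<theta>\<^sup>2 = 2 \<or> \<theta> = 3 \<or> \<theta> = - 3"
proof -
  have AA: "A *v (A *v v) = \<theta>\<^sup>2 *s v"
    by (simp add: v vec_lin vector_smult_assoc power2_eq_square)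
  have "A *v (A *v (A *v (A *v v) - 2 *s v)) = ((\<theta>\<^sup>2 - 2) * \<theta>\<^sup>2) *s v"
    by (simp add: AA vec_lin vector_smult_assoc) (simp add: Finite_Cartesian_Product.vec_eq_iff algebra_simps)
  moreover have "9 *s (A *v (A *v v) - 2 *s v) = ((\<theta>\<^sup>2 - 2) * 9) *s v"
    by (simp add: AA Finite_Cartesian_Product.vec_eq_iff algebra_simps)
  ultimately have "((\<theta>\<^sup>2 - 2) * \<theta>\<^sup>2) *s v = ((\<theta>\<^sup>2 - 2) * 9) *s v"
    using square_polynomial[of v] by simp
  moreover obtain y where "v $ y \<noteq> 0"
    using v by (auto simp: Finite_Cartesian_Product.vec_eq_iff)
  ultimately have "(\<theta>\<^sup>2 - 2) * \<theta>\<^sup>2 = (\<theta>\<^sup>2 - 2) * 9"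
    by (metis mult_cancel_right vector_smult_component)
  then have "(\<theta>\<^sup>2 - 2) * (\<theta>\<^sup>2 - 9) = 0"
    by (simp only: right_diff_distrib) simp
  then have "\<theta>\<^sup>2 = 2 \<or> \<theta>\<^sup>2 = 3\<^sup>2" by simp
  then show ?thesis by (metis power2_eq_iff)
qed

lemma spectrum:
  assumes "CARD('v) = 14"
  defines "r \<equiv> complex_of_real (sqrt 2)"
  shows "spectrum_mult A = {(3, 1), (r, 6), (- r, 6), (- 3, 1)}"
proof -
  have r: "r\<^sup>2 = 2"
    unfolding r_def by (simp flip: of_real_power)
  have "\<theta> = r \<or> \<theta> = - r" if "\<theta>\<^sup>2 = 2" for \<theta>
    using that r by (metis power2_eq_iff)
  note dims = dim_eigenspace_3 dim_eigenspace_3[folded eigenspace_dim_neg[of 3]]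
    dim_eigenspace_sqrt2[OF assms(1) r] dim_eigenspace_sqrt2[OF assms(1), of "- r"]
  have "\<theta> \<in> {3, r, - r, - 3}" if nz: "eigenspace A \<theta> \<noteq> {0}" for \<theta>
  proof -
    have "0 \<in> eigenspace A \<theta>" by (simp add: eigenspace_def)
    with nz obtain v where "A *v v = \<theta> *s v" "v \<noteq> 0"
      by (auto simp: eigenspace_def)
    then have "\<theta>\<^sup>2 = 2 \<or> \<theta> = 3 \<or> \<theta> = - 3" by (rule eigenvalue_cases)
    with r show ?thesis by (metis insertCI power2_eq_iff)
  qed
  moreover have "vec.dim (eigenspace A 3) = 1" "vec.dim (eigenspace A (- 3)) = 1"
    "vec.dim (eigenspace A r) = 6" "vec.dim (eigenspace A (- r)) = 6"
    using dim_eigenspace_3 dim_eigenspace_sqrt2[OF assms(1) r] by (simp_all add: eigenspace_dim_neg)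
  moreover from this have "eigenspace A \<theta> \<noteq> {0}" if "\<theta> \<in> {3, r, - r, - 3}" for \<theta>
    using that by fastforce
  ultimately show ?thesis
    unfolding spectrum_mult_def by (auto simp del: One_nat_def)
qed

end

section \<open>Eigenvalues of the representing matrices\<close>

lemma less_4_cases: "i < 4 \<longleftrightarrow> i = 0 \<or> i = 1 \<or> i = 2 \<or> i = (3 :: nat)"
  by linarith

lemma less_2_iff: "i < 2 \<longleftrightarrow> i = 0 \<or> i = (1 :: nat)"
  by linarith

lemma sum_less_4: "(\<Sum>i<4. f i) = f 0 + f 1 + f 2 + f (3 :: nat)"
  by (simp add: eval_nat_numeral)

lemma sum_less_2: "(\<Sum>i<2. f i) = f 0 + f (1 :: nat)"
  by (simp add: eval_nat_numeral)

text \<open>Vectors become functions on indices, so that each concrete matrix turns into a small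
  system of scalar equations.\<close>

lemma eigenvalue_iff:
  assumes "B \<in> carrier_mat n n"
  shows "eigenvalue B \<theta> \<longleftrightarrow> (\<exists>f. (\<exists>i<n. f i \<noteq> 0) \<and> (\<forall>i<n. (\<Sum>j<n. B $$ (i, j) * f j) = \<theta> * f i))"
    (is "_ \<longleftrightarrow> ?R")
proof
  have dims: "dim_row B = n" "dim_col B = n" using assms by auto
  have mult: "vec_index (B *\<^sub>v v) i = (\<Sum>j<n. B $$ (i, j) * vec_index v j)" if "v \<in> carrier_vec n" "i < n" for v i
    using that dims by (simp add: scalar_prod_def atLeast0LessThan)
  show ?R if "eigenvalue B \<theta>"
  proof -
    obtain v where v: "v \<in> carrier_vec n" "v \<noteq> 0\<^sub>v n" "B *\<^sub>v v = \<theta> \<cdot>\<^sub>v v"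
      using \<open>eigenvalue B \<theta>\<close> dims by (auto simp: eigenvalue_def eigenvector_def)
    have "\<exists>i<n. vec_index v i \<noteq> 0"
      using v(1,2) by (metis carrier_vecD eq_vecI index_zero_vec)
    moreover have "(\<Sum>j<n. B $$ (i, j) * vec_index v j) = \<theta> * vec_index v i" if "i < n" for i
      using mult[OF v(1) that] v(1,3) that by simp
    ultimately show ?thesis by blast
  qed
  show "eigenvalue B \<theta>" if ?R
  proof -
    obtain f where f: "\<exists>i<n. f i \<noteq> 0" "\<forall>i<n. (\<Sum>j<n. B $$ (i, j) * f j) = \<theta> * f i"
      using \<open>?R\<close> by blast
    let ?v = "Matrix.vec n f"
    have "?v \<noteq> 0\<^sub>v n" using f(1) by (metis index_vec index_zero_vec(1))
    moreover have "B *\<^sub>v ?v = \<theta> \<cdot>\<^sub>v ?v"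
    proof (rule eq_vecI)
      fix i assume "i < dim_vec (\<theta> \<cdot>\<^sub>v ?v)"
      then have i: "i < n" by simp
      have "vec_index (B *\<^sub>v ?v) i = (\<Sum>j<n. B $$ (i, j) * f j)"
        unfolding mult[of ?v, OF vec_carrier i] by (rule sum.cong) simp_all
      then show "vec_index (B *\<^sub>v ?v) i = vec_index (\<theta> \<cdot>\<^sub>v ?v) i"
        using f(2) i by simp
    qed (simp add: dims)
    ultimately show ?thesis
      using dims unfolding eigenvalue_def eigenvector_def by (intro exI[of _ ?v]) simp
  qed
qed

context
  fixes r :: complex assumes r: "r\<^sup>2 = 2"
begin

lemma eigenvalues_2:
  "{\<theta>. eigenvalue (mat_of_rows_list 2 [[0, 2], [1, 0]]) \<theta>} = {r, - r}"
proof -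
  let ?B = "mat_of_rows_list 2 [[0, 2], [1, 0 :: complex]]"
  have B: "?B \<in> carrier_mat 2 2"
    by (intro carrier_matI) (simp_all add: mat_of_rows_list_def)
  have eqs: "(\<exists>i<2. f i \<noteq> 0) \<and> (\<forall>i<2. (\<Sum>j<2. ?B $$ (i, j) * f j) = \<theta> * f i) \<longleftrightarrow>
      (f 0 \<noteq> 0 \<or> f 1 \<noteq> 0) \<and> 2 * f 1 = \<theta> * f 0 \<and> f 0 = \<theta> * f 1" for f \<theta>
    by (auto simp: less_2_iff sum_less_2 mat_of_rows_list_def simp del: One_nat_def)
  have "eigenvalue ?B \<theta> \<longleftrightarrow> \<theta>\<^sup>2 = 2" for \<theta>
    unfolding eigenvalue_iff[OF B] eqs
  proof (rule iffI, elim exE conjE)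
    fix f :: "nat \<Rightarrow> complex"
    assume nz: "f 0 \<noteq> 0 \<or> f 1 \<noteq> 0" and f: "2 * f 1 = \<theta> * f 0" "f 0 = \<theta> * f 1"
    have "f 1 \<noteq> 0" using nz f(2) by auto
    moreover have "2 * f 1 = \<theta>\<^sup>2 * f 1"
      unfolding f(1) by (simp add: f(2) power2_eq_square)
    ultimately show "\<theta>\<^sup>2 = 2" by simp
  next
    assume "\<theta>\<^sup>2 = 2"
    then show "\<exists>f. (f 0 \<noteq> 0 \<or> f (1 :: nat) \<noteq> 0) \<and> 2 * f 1 = \<theta> * f 0 \<and> f 0 = \<theta> * f 1"
      by (intro exI[of _ "\<lambda>i. if i = 0 then \<theta> else 1"]) (simp add: power2_eq_square)
  qed
  then show ?thesis using r by (auto simp: power2_eq_iff[of _ r, unfolded r])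
qed

lemma eigenvalues_4:
  "{\<theta>. eigenvalue (mat_of_rows_list 4 [[0, 3, 0, 0], [1, 0, 2, 0], [0, 1, 0, 2], [0, 0, 3, 0]]) \<theta>}
    = {3, r, - r, - 3}"
proof -
  let ?B = "mat_of_rows_list 4 [[0, 3, 0, 0], [1, 0, 2, 0], [0, 1, 0, 2], [0, 0, 3, 0 :: complex]]"
  have B: "?B \<in> carrier_mat 4 4"
    by (intro carrier_matI) (simp_all add: mat_of_rows_list_def)
  have eqs: "(\<exists>i<4. f i \<noteq> 0) \<and> (\<forall>i<4. (\<Sum>j<4. ?B $$ (i, j) * f j) = \<theta> * f i) \<longleftrightarrow>
      (f 0 \<noteq> 0 \<or> f 1 \<noteq> 0 \<or> f 2 \<noteq> 0 \<or> f 3 \<noteq> 0) \<and> 3 * f 1 = \<theta> * f 0 \<and> f 0 + 2 * f 2 = \<theta> * f 1 \<and>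
      f 1 + 2 * f 3 = \<theta> * f 2 \<and> 3 * f 2 = \<theta> * f 3" for f \<theta>
    by (auto simp: less_4_cases sum_less_4 mat_of_rows_list_def simp del: One_nat_def)
  have "eigenvalue ?B \<theta> \<longleftrightarrow> \<theta>\<^sup>2 = 2 \<or> \<theta> = 3 \<or> \<theta> = - 3" for \<theta>
    unfolding eigenvalue_iff[OF B] eqs
  proof (rule iffI, elim exE conjE)
    fix f :: "nat \<Rightarrow> complex"
    assume nz: "f 0 \<noteq> 0 \<or> f 1 \<noteq> 0 \<or> f 2 \<noteq> 0 \<or> f 3 \<noteq> 0" and f: "3 * f 1 = \<theta> * f 0"
      "f 0 + 2 * f 2 = \<theta> * f 1" "f 1 + 2 * f 3 = \<theta> * f 2" "3 * f 2 = \<theta> * f 3"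
    \<comment> \<open>The first three rows express all entries through \<open>f 0\<close>, with
      denominators cleared; the last row then gives the characteristic equation.\<close>
    have "6 * f 2 = 3 * (f 0 + 2 * f 2) - 3 * f 0" by simp
    also have "\<dots> = \<theta> * (3 * f 1) - 3 * f 0" unfolding f(2) by simp
    also have "\<dots> = (\<theta>\<^sup>2 - 3) * f 0"
      unfolding f(1) by (simp add: algebra_simps power2_eq_square)
    finally have 2: "6 * f 2 = (\<theta>\<^sup>2 - 3) * f 0" .
    have "12 * f 3 = 6 * (f 1 + 2 * f 3) - 2 * (3 * f 1)" by simp
    also have "\<dots> = \<theta> * (6 * f 2) - 2 * (\<theta> * f 0)" unfolding f(1,3) by simp
    also have "\<dots> = \<theta> * (\<theta>\<^sup>2 - 5) * f 0"
      unfolding 2 by (simp add: algebra_simps)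
    finally have 3: "12 * f 3 = \<theta> * (\<theta>\<^sup>2 - 5) * f 0" .
    have "6 * (6 * f 2) = \<theta> * (12 * f 3)"
      using f(4) by simp
    then have "(\<theta>\<^sup>2 - 2) * (\<theta>\<^sup>2 - 9) * f 0 = 0"
      unfolding 2 3 by (simp add: algebra_simps power2_eq_square)
    moreover have "f 0 \<noteq> 0" using nz f(1) 2 3 by auto
    ultimately have "\<theta>\<^sup>2 = 2 \<or> \<theta>\<^sup>2 = 3\<^sup>2" by simp
    then show "\<theta>\<^sup>2 = 2 \<or> \<theta> = 3 \<or> \<theta> = - 3" by (metis power2_eq_iff)
  next
    assume \<theta>: "\<theta>\<^sup>2 = 2 \<or> \<theta> = 3 \<or> \<theta> = - 3"
    show "\<exists>f. (f 0 \<noteq> 0 \<or> f 1 \<noteq> 0 \<or> f 2 \<noteq> 0 \<or> f (3 :: nat) \<noteq> 0) \<and> 3 * f 1 = \<theta> * f 0 \<and>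
        f 0 + 2 * f 2 = \<theta> * f 1 \<and> f 1 + 2 * f 3 = \<theta> * f 2 \<and> 3 * f 2 = \<theta> * f 3"
    proof (cases "\<theta>\<^sup>2 = 2")
      case True
      \<comment> \<open>The entries come from the two formulas for \<open>6 * f 2\<close> and
        \<open>12 * f 3\<close> above, with \<open>\<theta>\<^sup>2 = 2\<close> and
        \<open>f 0 = 12\<close> to avoid fractions.\<close>
      then show ?thesis
        by (intro exI[of _ "\<lambda>i. if i = 0 then 12 else if i = 1 then 4 * \<theta> else if i = 2 then - 2 else - 3 * \<theta>"])
          (simp add: power2_eq_square)
    next
      case False
      \<comment> \<open>The constant vector for 3 and the alternating one for -3.\<close>
      with \<theta> show ?thesis
        by (intro exI[of _ "\<lambda>i. (\<theta> / 3) ^ i"]) (auto simp: power2_eq_square power3_eq_cube)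
    qed
  qed
  then show ?thesis using r by (auto simp: power2_eq_iff[of _ r, unfolded r])
qed

end

context labelled_heawood_graph
begin

lemma F_seed: "seed t v \<Longrightarrow> t \<in> {1, 2} \<Longrightarrow> F t *v v = v"
  by (auto simp: seed_def e_pos)

lemma A_A_seed: "seed t v \<Longrightarrow> t \<in> {1, 2} \<Longrightarrow> A *v (A *v v) = 2 *s v"
  using A_A_F[of t v] F_seed by simp

lemma represents_seed:
  assumes "seed t v" "t \<in> {1, 2}"
  shows "represents (mat_of_rows_list 2 [[0, 2], [1, 0]]) A [v, A *v v]"
  unfolding represents_def
  by (auto simp: less_2_iff sum_less_2 mat_of_rows_list_def A_A_seed[OF assms]
      simp flip: numeral_2_eq_2)

lemma represents_spheres:
  "represents (mat_of_rows_list 4 [[0, 3, 0, 0], [1, 0, 2, 0], [0, 1, 0, 2], [0, 0, 3, 0]]) A [s 0, s 1, s 2, s 3]"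
proof -
  have "length [s 0, s 1, s 2, s 3] = 4" by simp
  then show ?thesis
    unfolding represents_def
    by (simp only: less_4_cases sum_less_4)
      (auto simp: mat_of_rows_list_def A_s simp del: One_nat_def)
qed

lemma upt_last_index: "[0..<Suc (last_index 0)] = [0, 1, 2, 3]"
  "t \<in> {1, 2} \<Longrightarrow> [t..<Suc (last_index t)] = [t, Suc t]"
  by (auto simp: last_index_def upt_rec)

lemma module_data_W0:
  "module_data adj x W0 0 1 4 3 [1, 1, 1, 1] [s 0, s 1, s 2, s 3]
     (mat_of_rows_list 4 [[0, 3, 0, 0], [1, 0, 2, 0], [0, 1, 0, 2], [0, 0, 3, 0]])"
proof -
  have m: "length (filter (of_type 0) [W0, W1a, W1b, W2a, W2b, W2c]) = 1"
    by (simp add: seeds[THEN of_type_cyclic])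
  have vs: "[s 0, s 1, s 2, s 3] = map (\<lambda>i. e 0 i 0 *v s 0) [0..<Suc (last_index 0)]"
    unfolding upt_last_index by (simp add: e_0 dot_s_s)
  have \<delta>: "3 = last_index 0 - 0" by (simp add: last_index_def)
  have "replicate (Suc 3) (1 :: nat) = [1, 1, 1, 1]" "Suc 3 = 4"
    by (simp_all add: eval_nat_numeral)
  then show ?thesis
    using module_data_cyclic(1)[OF seeds(1) decomposition m vs \<delta> represents_spheres] by metis
qed

lemma module_data_seed:
  assumes "seed t v" "t \<in> {1, 2}"
  shows "module_data adj x (cyclic v) t (Suc t) 2 1 [1, 1] [v, A *v v] (mat_of_rows_list 2 [[0, 2], [1, 0]])"
    "endpoint adj x (cyclic v) = t" "A *v v = D (Suc t) *v (A *v v)"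
proof -
  \<comment> \<open>There are two seeds for \<open>t = 1\<close> and three for \<open>t = 2\<close>,
    so \<open>Suc t\<close> states both multiplicities at once.\<close>
  have m: "length (filter (of_type t) [W0, W1a, W1b, W2a, W2b, W2c]) = Suc t"
    using assms(2) by (auto simp: seeds[THEN of_type_cyclic])
  have vs: "[v, A *v v] = map (\<lambda>i. e t i t *v v) [t..<Suc (last_index t)]"
    unfolding upt_last_index(2)[OF assms(2)] using F_seed[OF assms] assms(2) by (auto simp: e_pos)
  have \<delta>: "1 = last_index t - t" using assms(2) by (auto simp: last_index_def)
  note data = module_data_cyclic[OF assms(1) decomposition m vs \<delta> represents_seed[OF assms]]
  show "module_data adj x (cyclic v) t (Suc t) 2 1 [1, 1] [v, A *v v] (mat_of_rows_list 2 [[0, 2], [1, 0]])"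
    using data(1) by (simp add: numeral_2_eq_2)
  show "endpoint adj x (cyclic v) = t" by (rule data(2))
  show "A *v v = D (Suc t) *v (A *v v)"
    using A_F[OF assms(2), of "Suc t" v] F_seed[OF assms] by simp
qed

lemma seed_vectors:
  "seed_vector adj x W1a [u1, u2, u3] [1, - 1, 0] \<nu>1a"
  "seed_vector adj x W1b [u1, u2, u3] [1, 1, - 2] \<nu>1b"
  "seed_vector adj x W2a [y1, y2, y3, y4, y5, y6] [1, - 1, 0, 0, 0, 0] \<nu>2a"
  "seed_vector adj x W2b [y1, y2, y3, y4, y5, y6] [0, 0, 1, - 1, 0, 0] \<nu>2b"
  "seed_vector adj x W2c [y1, y2, y3, y4, y5, y6] [0, 0, 0, 0, 1, - 1] \<nu>2c"
  using us_distinct ys_distinct us_sphere ys_sphere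
  by (intro seed_vector_cyclic[OF seeds(2)] seed_vector_cyclic[OF seeds(3)] seed_vector_cyclic[OF seeds(4)]
      seed_vector_cyclic[OF seeds(5)] seed_vector_cyclic[OF seeds(6)] module_data_seed(2) seeds;
      auto simp: essential_part_def \<nu>_defs b_nth)+

lemma isomorphic_iff:
  assumes "i < 6" "j < 6"
  shows "isomorphic_modules alg ([W0, W1a, W1b, W2a, W2b, W2c] ! i) ([W0, W1a, W1b, W2a, W2b, W2c] ! j)
    \<longleftrightarrow> [1, 2, 2, 3, 3, 3 :: nat] ! i = [1, 2, 2, 3, 3, 3] ! j"
proof -
  \<comment> \<open>The labels 1, 2, 3 stand for the blocks 0, 1, 2. Positivity is recorded because
    subtraction truncates at zero and would otherwise not be injective.\<close>
  have "\<exists>v. [W0, W1a, W1b, W2a, W2b, W2c] ! i = cyclic v \<and> seed ([1, 2, 2, 3, 3, 3] ! i - 1) v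
      \<and> [1, 2, 2, 3, 3, 3] ! i > (0 :: nat)" if "i < 6" for i
  proof -
    have "i = 0 \<or> i = 1 \<or> i = 2 \<or> i = 3 \<or> i = 4 \<or> i = 5" using that by linarith
    then show ?thesis using seeds by (elim disjE) (auto simp: numeral_2_eq_2)
  qed
  from this[OF assms(1)] this[OF assms(2)] show ?thesis
    using isomorphic_cyclic_iff by (metis Suc_pred')
qed

lemma dim_alg_24: "cmat.dim alg = 24"
proof -
  have "I 0 = {0, 1, 2, 3}" "I 1 = {1, 2}" "I 2 = {2, 3}" by (auto simp: I_def)
  then show ?thesis
    unfolding dim_alg by (simp add: types_def power2_eq_square)
qed

end

theorem mainTheorem5:
  fixes adj :: "'v::finite \<Rightarrow> 'v \<Rightarrow> bool"
    and x u1 u2 u3 y1 y2 y3 y4 y5 y6 :: 'v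
  assumes "distance_regular adj"
    and "CARD('v) = 14"
    and "intersection_array adj = ([3, 2, 2], [1, 1, 3])"
    and "distinct [u1, u2, u3]" and "set [u1, u2, u3] = dist_sphere adj 1 x"
    and "distinct [y1, y2, y3, y4, y5, y6]"
    and "set [y1, y2, y3, y4, y5, y6] = dist_sphere adj 2 x"
    and "\<exists>u \<in> dist_sphere adj 1 x. adj u y1 \<and> adj u y2"
    and "\<exists>u \<in> dist_sphere adj 1 x. adj u y3 \<and> adj u y4"
    and "\<exists>u \<in> dist_sphere adj 1 x. adj u y5 \<and> adj u y6"
  defines "A \<equiv> adjacency_matrix adj"
    and "T \<equiv> terwilliger_algebra adj x"
    and "s \<equiv> complex_of_real (sqrt 2)"
    and "B1 \<equiv> mat_of_rows_list 4 [[0, 3, 0, 0], [1, 0, 2, 0], [0, 1, 0, 2], [0, 0, 3, 0]]"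
    and "B2 \<equiv> mat_of_rows_list 2 [[0, 2], [1, 0]]"
    and "us \<equiv> [u1, u2, u3]"
    and "ys \<equiv> [y1, y2, y3, y4, y5, y6]"
  shows "spectrum_mult A = {(3, 1), (s, 6), (- s, 6), (- 3, 1)} \<and>
    (\<exists>W0 W1a W1b W2a W2b W2c \<nu>1a \<nu>1b \<nu>2a \<nu>2b \<nu>2c.
      orthogonal_irreducible_decomposition T [W0, W1a, W1b, W2a, W2b, W2c] \<and>
      (let Ws = [W0, W1a, W1b, W2a, W2b, W2c]; types = [1, 2, 2, 3, 3, 3 :: nat]
       in \<forall>i < 6. \<forall>j < 6. isomorphic_modules T (Ws ! i) (Ws ! j) \<longleftrightarrow> types ! i = types ! j) \<and>

      module_data adj x W0 0 1 4 3 [1, 1, 1, 1]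
        [sphere_vector adj x 0, sphere_vector adj x 1, sphere_vector adj x 2, sphere_vector adj x 3]
        B1 \<and>
      {\<theta>. eigenvalue B1 \<theta>} = {3, s, - s, - 3} \<and>

      seed_vector adj x W1a us [1, - 1, 0] \<nu>1a \<and>
      seed_vector adj x W1b us [1, 1, - 2] \<nu>1b \<and>
      (\<forall>(W, \<nu>) \<in> {(W1a, \<nu>1a), (W1b, \<nu>1b)}.
         module_data adj x W 1 2 2 1 [1, 1] [\<nu>, A *v \<nu>] B2 \<and>
         A *v \<nu> = dual_idempotent adj x 2 *v (A *v \<nu>)) \<and>
      {\<theta>. eigenvalue B2 \<theta>} = {s, - s} \<and>

      seed_vector adj x W2a ys [1, - 1, 0, 0, 0, 0] \<nu>2a \<and>
      seed_vector adj x W2b ys [0, 0, 1, - 1, 0, 0] \<nu>2b \<and>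
      seed_vector adj x W2c ys [0, 0, 0, 0, 1, - 1] \<nu>2c \<and>
      (\<forall>(W, \<nu>) \<in> {(W2a, \<nu>2a), (W2b, \<nu>2b), (W2c, \<nu>2c)}.
         module_data adj x W 2 3 2 1 [1, 1] [\<nu>, A *v \<nu>] B2 \<and>
         A *v \<nu> = dual_idempotent adj x 3 *v (A *v \<nu>))) \<and>
    cmat.dim T = 4 ^ 2 + 2 ^ 2 + 2 ^ 2 \<and> cmat.dim T = 24"
proof -
  interpret H: labelled_heawood_graph adj x u1 u2 u3 y1 y2 y3 y4 y5 y6
    using assms(1,3-10) by unfold_locales
  have T: "T = H.alg"
    unfolding T_def by (rule H.terwilliger_algebra_eq)
  have s: "s\<^sup>2 = 2"
    unfolding s_def by (simp flip: of_real_power)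
  have spectrum: "spectrum_mult A = {(3, 1), (s, 6), (- s, 6), (- 3, 1)}"
    unfolding A_def s_def by (rule H.spectrum[OF assms(2)])
  have iso: "let Ws = [H.W0, H.W1a, H.W1b, H.W2a, H.W2b, H.W2c]; types = [1, 2, 2, 3, 3, 3 :: nat]
      in \<forall>i < 6. \<forall>j < 6. isomorphic_modules T (Ws ! i) (Ws ! j) \<longleftrightarrow> types ! i = types ! j"
    unfolding Let_def T using H.isomorphic_iff by blast
  have II: "module_data adj x (H.cyclic v) 1 2 2 1 [1, 1] [v, A *v v] B2"
    "A *v v = dual_idempotent adj x 2 *v (A *v v)" if "H.seed 1 v" for v
    using H.module_data_seed(1,3)[OF that] unfolding A_def B2_def by (simp_all add: numeral_2_eq_2)
  have III: "module_data adj x (H.cyclic v) 2 3 2 1 [1, 1] [v, A *v v] B2"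
    "A *v v = dual_idempotent adj x 3 *v (A *v v)" if "H.seed 2 v" for v
    using H.module_data_seed(1,3)[OF that] unfolding A_def B2_def by simp_all
  have dim: "cmat.dim T = 24"
    unfolding T by (rule H.dim_alg_24)
  show ?thesis
  proof (intro conjI spectrum exI)
    show "orthogonal_irreducible_decomposition T [H.W0, H.W1a, H.W1b, H.W2a, H.W2b, H.W2c]"
      unfolding T by (rule H.decomposition)
    show "module_data adj x H.W0 0 1 4 3 [1, 1, 1, 1]
        [sphere_vector adj x 0, sphere_vector adj x 1, sphere_vector adj x 2, sphere_vector adj x 3] B1"
      unfolding B1_def by (rule H.module_data_W0)
    show "{\<theta>. eigenvalue B1 \<theta>} = {3, s, - s, - 3}"
      unfolding B1_def by (rule eigenvalues_4[OF s])
    show "{\<theta>. eigenvalue B2 \<theta>} = {s, - s}"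
      unfolding B2_def by (rule eigenvalues_2[OF s])
    show "seed_vector adj x H.W1a us [1, - 1, 0] H.\<nu>1a" "seed_vector adj x H.W1b us [1, 1, - 2] H.\<nu>1b"
      "seed_vector adj x H.W2a ys [1, - 1, 0, 0, 0, 0] H.\<nu>2a"
      "seed_vector adj x H.W2b ys [0, 0, 1, - 1, 0, 0] H.\<nu>2b"
      "seed_vector adj x H.W2c ys [0, 0, 0, 0, 1, - 1] H.\<nu>2c"
      unfolding us_def ys_def by (rule H.seed_vectors)+
    show "\<forall>(W, \<nu>) \<in> {(H.W1a, H.\<nu>1a), (H.W1b, H.\<nu>1b)}.
        module_data adj x W 1 2 2 1 [1, 1] [\<nu>, A *v \<nu>] B2 \<and>
        A *v \<nu> = dual_idempotent adj x 2 *v (A *v \<nu>)"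
      using II[OF H.seeds(2)] II[OF H.seeds(3)] by auto
    show "\<forall>(W, \<nu>) \<in> {(H.W2a, H.\<nu>2a), (H.W2b, H.\<nu>2b), (H.W2c, H.\<nu>2c)}.
        module_data adj x W 2 3 2 1 [1, 1] [\<nu>, A *v \<nu>] B2 \<and>
        A *v \<nu> = dual_idempotent adj x 3 *v (A *v \<nu>)"
      using III[OF H.seeds(4)] III[OF H.seeds(5)] III[OF H.seeds(6)] by auto
  qed (use iso dim in simp_all)
qed

end
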